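(* Let $U$ be a bounded open subset of $\mathbb{R}^d$ with $d\ge 2$, and let $\gamma\in[1,\infty)$ be a constant. Let $u\in H^{1,2}(U)$, $\phi\in H^{1,2}(U)\cap L^\infty(U)$, $\mathbf{H}\in L^2(U,\mathbb{R}^d)$, $c\in L^1(U)$ with $cu\in L^1(U)$, and $f\in L^1(U)$. Fix a constant $k>0$ and set $\eta:=k e^{-\phi/\gamma}$ in $U$. Then the following are equivalent: (i) For all $\varphi\in C_0^\infty(U)$, $$\int_U\Big(\langle\gamma\nabla u,\nabla\varphi\rangle+\langle\nabla\phi+\mathbf{H},\nabla u\rangle\,\varphi+c\,u\,\varphi\Big)\,dx=\int_U f\,\varphi\,dx.$$ (ii) For all $\psi\in C_0^\infty(U)$, $$\int_U\Big(\langle\gamma\eta\nabla u,\nabla\psi\rangle+\langle\eta\mathbf{H},\nabla u\rangle\,\psi+\eta c\,u\,\psi\Big)\,dx=\int_U\eta f\,\psi\,dx.$$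
   Context: $H^{1,2}(U)$ is the Sobolev space of functions in $L^2(U)$ with weak gradient in $L^2(U,\mathbb{R}^d)$; $\langle\cdot,\cdot\rangle$ is the Euclidean inner product; $C_0^\infty(U)$ is the space of smooth functions with compact support in $U$. *)

theory Defs
  imports "HOL-Analysis.Analysis"
begin

text \<open>
  Elements of Lebesgue and Sobolev spaces are represented by total functions on
  \<open>\<real>\<^sup>d\<close>; only their values on \<open>U\<close> (up to null sets) matter. The space
  \<open>L\<^sup>1(U)\<close> is \<^term>\<open>integrable (lebesgue_on U)\<close>.
\<close>

definition L2 :: "(real^'d) set \<Rightarrow> (real^'d \<Rightarrow> 'b::euclidean_space) set" where
  "L2 U = {f. f \<in> borel_measurable (lebesgue_on U) \<and>
              integrable (lebesgue_on U) (\<lambda>x. (norm (f x))\<^sup>2)}"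

definition Linfty :: "(real^'d) set \<Rightarrow> (real^'d \<Rightarrow> real) set" where
  "Linfty U = {f. f \<in> borel_measurable (lebesgue_on U) \<and>
                  (\<exists>C. AE x in lebesgue_on U. \<bar>f x\<bar> \<le> C)}"

definition partial :: "'d \<Rightarrow> (real^'d \<Rightarrow> real) \<Rightarrow> real^'d \<Rightarrow> real" where
  "partial i f x = frechet_derivative f (at x) (axis i 1)"

definition grad :: "(real^'d \<Rightarrow> real) \<Rightarrow> real^'d \<Rightarrow> real^'d" where
  "grad f x = (\<chi> i. partial i f x)"

text \<open>
  A function is smooth iff all its iterated partial derivatives (listed by
  \<open>is\<close>, including \<open>f\<close> itself for \<open>is = []\<close>) are differentiable everywhere.
\<close>

definition smooth :: "(real^'d \<Rightarrow> real) \<Rightarrow> bool" where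
  "smooth f \<longleftrightarrow> (\<forall>is. foldr partial is f differentiable_on UNIV)"

text \<open>
  \<open>C\<^sub>0\<^sup>\<infinity>(U)\<close>: as usual, its elements are identified with their extensions by zero
  to \<open>\<real>\<^sup>d\<close>.
\<close>

definition test_functions :: "(real^'d) set \<Rightarrow> (real^'d \<Rightarrow> real) set" where
  "test_functions U = {\<psi>. smooth \<psi> \<and> compact (closure {x. \<psi> x \<noteq> 0}) \<and>
                           closure {x. \<psi> x \<noteq> 0} \<subseteq> U}"

text \<open>
  This relation is only used for \<open>u\<close> and \<open>g\<close> in \<^const>\<open>L2\<close>, where both integrands
  are integrable.
\<close>

definition has_weak_gradient ::
  "(real^'d) set \<Rightarrow> (real^'d \<Rightarrow> real) \<Rightarrow> (real^'d \<Rightarrow> real^'d) \<Rightarrow> bool" where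
  "has_weak_gradient U u g \<longleftrightarrow>
     (\<forall>\<psi>\<in>test_functions U. \<forall>i.
        (\<integral>x. u x * partial i \<psi> x \<partial>lebesgue_on U) = - (\<integral>x. g x $ i * \<psi> x \<partial>lebesgue_on U))"

definition H12 :: "(real^'d) set \<Rightarrow> (real^'d \<Rightarrow> real) set" where
  "H12 U = {u \<in> L2 U. \<exists>g\<in>L2 U. has_weak_gradient U u g}"

text \<open>
  For \<open>u\<close> in \<^const>\<open>H12\<close> and open \<open>U\<close> the weak gradient is unique up to null sets in \<open>U\<close>;
  we pick a representative.
\<close>

definition weak_grad :: "(real^'d) set \<Rightarrow> (real^'d \<Rightarrow> real) \<Rightarrow> real^'d \<Rightarrow> real^'d" where
  "weak_grad U u = (SOME g. g \<in> L2 U \<and> has_weak_gradient U u g)"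

end

theory Submission
  imports Defs
begin

text \<open>
  Formally, statement (ii) is statement (i) tested with \<open>\<eta> \<psi>\<close>: since
  \<open>\<nabla>\<eta> = - (1/\<gamma>) \<eta> \<nabla>\<phi>\<close>, the gradient of the weight cancels the drift term
  \<open>\<langle>\<nabla>\<phi>, \<nabla>u\<rangle>\<close>; testing (ii) with \<open>\<psi> / \<eta>\<close> brings it back. As \<open>\<eta>\<close> is only a bounded Sobolev
  function, \<open>\<eta> \<psi>\<close> is not a test function. Both directions are instances of one lemma,
  \<open>weak_equation_exp_weight\<close>: if \<open>A \<in> L\<^sup>2\<close>, \<open>B \<in> L\<^sup>1\<close> and \<open>\<integral> A \<bullet> \<nabla>\<psi> + B \<psi> = 0\<close> for all test
  functions \<open>\<psi>\<close>, then
  \<open>\<integral> exp (a \<phi>) (A \<bullet> \<nabla>\<psi> + a (A \<bullet> \<nabla>\<phi>) \<psi> + B \<psi>) = 0\<close> for all test functions \<open>\<psi>\<close>. It is applied with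
  \<open>a = - 1/\<gamma>\<close>, \<open>A = \<gamma> \<nabla>u\<close> and with \<open>a = 1/\<gamma>\<close>, \<open>A = \<gamma> \<eta> \<nabla>u\<close>.

  For its proof, \<open>\<phi>\<close> is replaced by smooth functions \<open>p n\<close> that are uniformly bounded, converge to
  \<open>\<phi>\<close> almost everywhere in \<open>U\<close>, and whose gradients converge to \<open>\<nabla>\<phi>\<close> in \<open>L\<^sup>2\<close> on the support of
  \<open>\<psi>\<close> (\<open>smooth_approximation\<close>). Then \<open>exp (a p n) \<psi>\<close> is a test function, and the passage to
  the limit \<open>n \<rightarrow> \<infinity>\<close> is justified by dominated convergence and the Cauchy-Schwarz inequality
  (\<open>tendsto_integral_bounded_L2\<close>).

  The functions \<open>p n\<close> are convolutions with mollifiers. A mollifier is built from \<open>exp (-1/t)\<close>;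
  convolution with a mollifier is a contraction of \<open>L\<^sup>2\<close> by Jensen's inequality and Tonelli's theorem and, as
  its support shrinks, converges to the identity on continuous functions with compact support,
  which are dense.
\<close>

section \<open>Calculus of smooth functions\<close>

lemma partial_eq:
  assumes "(f has_derivative D) (at x)"
  shows "partial i f x = D (axis i 1)"
  using frechet_derivative_at[OF assms] by (simp add: partial_def)

lemma has_derivative_grad:
  fixes f :: "real^'d \<Rightarrow> real"
  assumes "f differentiable (at x)"
  shows "(f has_derivative (\<lambda>h. grad f x \<bullet> h)) (at x)"
proof -
  let ?D = "frechet_derivative f (at x)"
  have D: "(f has_derivative ?D) (at x)"
    using assms frechet_derivative_works by blast
  have lin: "linear ?D"
    using D has_derivative_linear by blast
  have "?D h = grad f x \<bullet> h" for h
  proof -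
    have "?D h = ?D (\<Sum>i\<in>UNIV. (h $ i) *\<^sub>R axis i 1)"
      by (metis (no_types, lifting) basis_expansion scalar_mult_eq_scaleR sum.cong)
    also have "\<dots> = (\<Sum>i\<in>UNIV. (h $ i) * ?D (axis i 1))"
      by (simp add: linear_sum[OF lin] linear_cmul[OF lin])
    also have "\<dots> = grad f x \<bullet> h"
      by (simp add: inner_vec_def grad_def partial_def mult.commute)
    finally show ?thesis .
  qed
  then show ?thesis using D by (metis (no_types, lifting) ext)
qed

text \<open>Coinduction: it suffices to place \<open>f\<close> in a set of differentiable functions that is stable under
  partial derivatives.\<close>

lemma smooth_coinduct:
  assumes "f \<in> S"
    and "\<And>g. g \<in> S \<Longrightarrow> g differentiable_on UNIV"
    and "\<And>g i. g \<in> S \<Longrightarrow> partial i g \<in> S"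
  shows "smooth f"
proof -
  have "foldr partial is f \<in> S" for "is"
    using assms by (induction "is") auto
  then show ?thesis
    using assms(2) by (auto simp: smooth_def)
qed

lemma smooth_partial: "smooth f \<Longrightarrow> smooth (partial i f)"
  unfolding smooth_def
proof
  fix "is" assume "\<forall>is. foldr partial is f differentiable_on UNIV"
  then have "foldr partial (is @ [i]) f differentiable_on UNIV" by blast
  then show "foldr partial is (partial i f) differentiable_on UNIV" by simp
qed

lemma smooth_differentiable: "smooth f \<Longrightarrow> f differentiable (at x)"
  unfolding smooth_def differentiable_on_def
  by (metis UNIV_I foldr.simps(1) id_apply)

lemma smooth_has_derivative:
  "smooth f \<Longrightarrow> (f has_derivative (\<lambda>h. grad f x \<bullet> h)) (at x)"
  by (simp add: has_derivative_grad smooth_differentiable)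

lemma smooth_continuous: "smooth f \<Longrightarrow> continuous_on S f"
  by (meson continuous_at_imp_continuous_on differentiable_imp_continuous_within smooth_differentiable)

lemma smooth_grad_continuous: "smooth f \<Longrightarrow> continuous_on S (grad f)"
  unfolding grad_def
  by (intro continuous_on_vec_lambda smooth_continuous smooth_partial)

lemma smooth_const: "smooth (\<lambda>x::real^'d. c)"
proof (rule smooth_coinduct[where S="range (\<lambda>c x. c)"])
  fix g :: "real^'d \<Rightarrow> real" and i assume "g \<in> range (\<lambda>c x. c)"
  then obtain c where g: "g = (\<lambda>x. c)" by auto
  have "partial i g = (\<lambda>x. 0)"
    unfolding g by (rule ext) (subst partial_eq[OF has_derivative_const], rule refl)
  then show "partial i g \<in> range (\<lambda>c x. c)" by auto
qed (auto simp: differentiable_on_def)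

lemma smooth_component: "smooth (\<lambda>x::real^'d. x $ j)"
proof (rule smooth_coinduct[where S="insert (\<lambda>x. x $ j) {f. smooth f}"])
  fix g :: "real^'d \<Rightarrow> real" and i assume g: "g \<in> insert (\<lambda>x. x $ j) {f. smooth f}"
  have d: "((\<lambda>x::real^'d. x $ j) has_derivative (\<lambda>x. x $ j)) (at x)" for x
    using bounded_linear_imp_has_derivative[OF bounded_linear_vec_nth] .
  then show "g differentiable_on UNIV"
    using g smooth_differentiable by (auto simp: differentiable_on_def differentiable_def)
  have "partial i (\<lambda>x::real^'d. x $ j) = (\<lambda>x. axis i 1 $ j)"
    using partial_eq[OF d] by blast
  then show "partial i g \<in> insert (\<lambda>x. x $ j) {f. smooth f}"
    using g smooth_const[of "axis i 1 $ j"] smooth_partial by auto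
qed simp

text \<open>
  The algebra generated by the smooth functions and by the compositions \<open>G n \<circ> q\<close>, where \<open>G n\<close>
  stands for the \<open>n\<close>-th derivative of a function on the line. It is stable under partial
  derivatives, so sums, products and compositions of smooth functions are smooth.
\<close>

inductive_set smooth_algebra ::
  "(nat \<Rightarrow> real \<Rightarrow> real) \<Rightarrow> (real^'d \<Rightarrow> real) \<Rightarrow> (real^'d \<Rightarrow> real) set" for G q where
  base: "smooth f \<Longrightarrow> f \<in> smooth_algebra G q"
| comp: "(\<lambda>x. G n (q x)) \<in> smooth_algebra G q"
| add: "f \<in> smooth_algebra G q \<Longrightarrow> g \<in> smooth_algebra G q \<Longrightarrow>
    (\<lambda>x. f x + g x) \<in> smooth_algebra G q"
| mult: "f \<in> smooth_algebra G q \<Longrightarrow> g \<in> smooth_algebra G q \<Longrightarrow>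
    (\<lambda>x. f x * g x) \<in> smooth_algebra G q"

lemma smooth_algebra_smooth:
  fixes q :: "real^'d \<Rightarrow> real"
  assumes f: "f \<in> smooth_algebra G q" and q: "smooth q"
    and G: "\<And>n t. (G n has_field_derivative G (Suc n) t) (at t)"
  shows "smooth f"
proof (rule smooth_coinduct[OF f])
  have "(\<forall>x. g differentiable (at x)) \<and> (\<forall>i. partial i g \<in> smooth_algebra G q)"
    if "g \<in> smooth_algebra G q" for g
    using that
  proof induction
    case (base f)
    then show ?case
      using smooth_algebra.base smooth_differentiable smooth_partial by blast
  next
    case (comp n)
    have d: "((\<lambda>x. G n (q x)) has_derivative (\<lambda>h. (grad q x \<bullet> h) * G (Suc n) (q x))) (at x)" for x
      using DERIV_compose_FDERIV[OF G smooth_has_derivative[OF q]] .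
    have "partial i (\<lambda>x. G n (q x)) = (\<lambda>x. partial i q x * G (Suc n) (q x))" for i
      by (rule ext) (simp add: partial_eq[OF d] inner_axis grad_def)
    moreover have "(\<lambda>x. partial i q x * G (Suc n) (q x)) \<in> smooth_algebra G q" for i
      by (intro smooth_algebra.intros smooth_partial q)
    ultimately show ?case
      using d by (auto simp: differentiable_def)
  next
    case (add f g)
    have df: "(f has_derivative (\<lambda>h. grad f x \<bullet> h)) (at x)" for x
      using add has_derivative_grad by blast
    have dg: "(g has_derivative (\<lambda>h. grad g x \<bullet> h)) (at x)" for x
      using add has_derivative_grad by blast
    have d: "((\<lambda>x. f x + g x) has_derivative (\<lambda>h. grad f x \<bullet> h + grad g x \<bullet> h)) (at x)" for x
      by (intro has_derivative_add df dg)
    have "partial i (\<lambda>x. f x + g x) = (\<lambda>x. partial i f x + partial i g x)" for i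
      by (rule ext) (simp add: partial_eq[OF d] inner_axis grad_def)
    then show ?case
      using d add by (auto simp: differentiable_def intro: smooth_algebra.intros)
  next
    case (mult f g)
    have df: "(f has_derivative (\<lambda>h. grad f x \<bullet> h)) (at x)" for x
      using mult has_derivative_grad by blast
    have dg: "(g has_derivative (\<lambda>h. grad g x \<bullet> h)) (at x)" for x
      using mult has_derivative_grad by blast
    have d: "((\<lambda>x. f x * g x) has_derivative
        (\<lambda>h. f x * (grad g x \<bullet> h) + (grad f x \<bullet> h) * g x)) (at x)" for x
      by (intro has_derivative_mult df dg)
    have "partial i (\<lambda>x. f x * g x) = (\<lambda>x. f x * partial i g x + partial i f x * g x)" for i
      by (rule ext) (simp add: partial_eq[OF d] inner_axis grad_def)
    then show ?case
      using d mult
      by (auto simp: differentiable_def intro!: smooth_algebra.add smooth_algebra.mult)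
  qed
  then show "g differentiable_on UNIV" "partial i g \<in> smooth_algebra G q"
    if "g \<in> smooth_algebra G q" for g i
    using that by (auto simp: differentiable_on_def)
qed

lemma smooth_compose:
  assumes "smooth q" and "\<And>n t. (G n has_field_derivative G (Suc n) t) (at t)"
  shows "smooth (\<lambda>x. G n (q x))"
  using smooth_algebra_smooth[OF smooth_algebra.comp] assms by blast

lemma smooth_add:
  assumes "smooth f" "smooth g" shows "smooth (\<lambda>x. f x + g x)"
  by (rule smooth_algebra_smooth[where G="\<lambda>_ _. 0" and q=f])
    (auto intro: smooth_algebra.intros assms)

lemma smooth_mult:
  assumes "smooth f" "smooth g" shows "smooth (\<lambda>x. f x * g x)"
  by (rule smooth_algebra_smooth[where G="\<lambda>_ _. 0" and q=f])
    (auto intro: smooth_algebra.intros assms)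

lemma smooth_exp:
  assumes "smooth p" shows "smooth (\<lambda>x. exp (a * p x))"
proof -
  have "((\<lambda>t. a ^ n * exp (a * t)) has_field_derivative a ^ Suc n * exp (a * t)) (at t)" for n t
    by (auto intro!: derivative_eq_intros)
  from smooth_compose[where G="\<lambda>n t. a ^ n * exp (a * t)" and n=0, OF assms this]
  show ?thesis by simp
qed

lemma smooth_sum:
  "finite I \<Longrightarrow> (\<And>i. i \<in> I \<Longrightarrow> smooth (f i)) \<Longrightarrow> smooth (\<lambda>x. \<Sum>i\<in>I. f i x)"
  by (induction rule: finite_induct) (auto intro: smooth_const smooth_add)

lemma smooth_reflect:
  assumes "smooth \<rho>" shows "smooth (\<lambda>y. \<rho> (x - y))"
    and "partial i (\<lambda>y. \<rho> (x - y)) y = - partial i \<rho> (x - y)"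
proof -
  have d: "((\<lambda>y. c * \<rho> (x - y)) has_derivative (\<lambda>h. c * - (grad \<rho> (x - y) \<bullet> h))) (at y)"
    if "smooth \<rho>" for \<rho> :: "real^'a \<Rightarrow> real" and c y
  proof -
    have "((\<lambda>y. x - y) has_derivative (\<lambda>h. - h)) (at y)"
      by (auto intro!: derivative_eq_intros)
    from has_derivative_compose[OF this smooth_has_derivative[OF that]]
    show ?thesis
      using has_derivative_mult_right[where x=c] by fastforce
  qed
  have p: "partial i (\<lambda>y. c * \<rho> (x - y)) = (\<lambda>y. (- c) * partial i \<rho> (x - y))"
    if "smooth \<rho>" for \<rho> :: "real^'a \<Rightarrow> real" and i c
    by (rule ext) (simp add: partial_eq[OF d[OF that]] inner_axis grad_def)
  show "partial i (\<lambda>y. \<rho> (x - y)) y = - partial i \<rho> (x - y)"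
    using p[OF assms, of i 1] by (auto dest: fun_cong)
  show "smooth (\<lambda>y. \<rho> (x - y))"
  proof (rule smooth_coinduct[where S="{\<lambda>y. c * \<rho> (x - y) | c \<rho>. smooth \<rho>}"])
    show "(\<lambda>y. \<rho> (x - y)) \<in> {\<lambda>y. c * \<rho> (x - y) | c \<rho>. smooth \<rho>}"
      using assms by (auto intro!: exI[of _ 1] exI[of _ \<rho>])
    show "g differentiable_on UNIV" if "g \<in> {\<lambda>y. c * \<rho> (x - y) | c \<rho>. smooth \<rho>}" for g
      using that d by (auto simp: differentiable_on_def differentiable_def)
    show "partial i g \<in> {\<lambda>y. c * \<rho> (x - y) | c \<rho>. smooth \<rho>}"
      if "g \<in> {\<lambda>y. c * \<rho> (x - y) | c \<rho>. smooth \<rho>}" for g i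
      using that p smooth_partial by blast
  qed
qed

lemma partial_eq_0:
  assumes "open V" "x \<in> V" "\<And>y. y \<in> V \<Longrightarrow> f y = 0"
  shows "partial i f x = 0"
proof -
  have "(f has_derivative (\<lambda>h. 0)) (at x)"
    by (rule has_derivative_transform_within_open[OF has_derivative_const[of 0] assms(1,2)])
      (simp add: assms(3))
  from partial_eq[OF this] show ?thesis by simp
qed

section \<open>Mollifiers\<close>

lemma poly_div_exp_tendsto_0:
  fixes p :: "real poly"
  shows "((\<lambda>s. poly p s * s ^ k / exp s) \<longlongrightarrow> 0) at_top"
proof (induction p arbitrary: k)
  case 0
  then show ?case by simp
next
  case (pCons a p)
  have "((\<lambda>s. a * (s ^ k / exp s) + poly p s * s ^ Suc k / exp s) \<longlongrightarrow> a * 0 + 0) at_top"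
    by (intro tendsto_intros pCons tendsto_power_div_exp_0)
  then show ?case by (simp add: algebra_simps add_divide_distrib)
qed

text \<open>
  The functions \<open>p (1/t) exp (-1/t)\<close>, with \<open>p\<close> a polynomial, extended by zero to \<open>t \<le> 0\<close>,
  are stable under differentiation.
\<close>

definition flat :: "real poly \<Rightarrow> real \<Rightarrow> real" where
  "flat p t = (if t > 0 then poly p (1 / t) / exp (1 / t) else 0)"

lemma flat_has_derivative:
  "(flat p has_field_derivative flat ([:0, 0, 1:] * (p - pderiv p)) t) (at t)"
proof -
  consider "t > 0" | "t < 0" | "t = 0" by linarith
  then show ?thesis
  proof cases
    case 1
    have "((\<lambda>t. poly p (1 / t) / exp (1 / t)) has_field_derivative
        flat ([:0, 0, 1:] * (p - pderiv p)) t) (at t)"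
      using 1
      by (auto intro!: derivative_eq_intros poly_DERIV[THEN DERIV_chain2]
          simp: flat_def field_simps power2_eq_square)
    then show ?thesis
      by (rule has_field_derivative_transform_within_open[where S="{0<..}"])
        (use 1 in \<open>auto simp: flat_def\<close>)
  next
    case 2
    have "((\<lambda>t. 0) has_field_derivative flat ([:0, 0, 1:] * (p - pderiv p)) t) (at t)"
      using 2 by (simp add: flat_def)
    then show ?thesis
      by (rule has_field_derivative_transform_within_open[where S="{..<0}"])
        (use 2 in \<open>auto simp: flat_def\<close>)
  next
    case 3
    have "((\<lambda>t. poly p (1 / t) * (1 / t) ^ 1 / exp (1 / t)) \<longlongrightarrow> 0) (at_right 0)"
      using filterlim_compose[OF poly_div_exp_tendsto_0[of p 1] filterlim_inverse_at_top_right]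
      unfolding inverse_eq_divide .
    then have R: "((\<lambda>t. flat p t / t) \<longlongrightarrow> 0) (at_right 0)"
      by (rule Lim_transform_eventually)
        (auto simp: flat_def eventually_at_filter)
    have L: "((\<lambda>t. flat p t / t) \<longlongrightarrow> 0) (at_left 0)"
      by (rule Lim_transform_eventually[OF tendsto_const])
        (auto simp: flat_def eventually_at_filter)
    have "((\<lambda>t. flat p t / t) \<longlongrightarrow> 0) (at 0)"
      using filterlim_split_at[OF L R] .
    then show ?thesis
      using 3 by (simp add: has_field_derivative_iff flat_def)
  qed
qed

text \<open>
  \<open>mollifier r \<rho>\<close>: \<open>\<rho>\<close> is a smooth probability density that vanishes outside the ball of
  radius \<open>r\<close>.
\<close>

definition mollifier :: "real \<Rightarrow> (real^'d \<Rightarrow> real) \<Rightarrow> bool" where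
  "mollifier r \<rho> \<longleftrightarrow> smooth \<rho> \<and> (\<forall>x. 0 \<le> \<rho> x) \<and> (\<forall>x. r \<le> norm x \<longrightarrow> \<rho> x = 0) \<and>
     (\<integral>x. \<rho> x \<partial>lborel) = 1"

lemma continuous_vanishing_integrable:
  fixes f :: "'a::euclidean_space \<Rightarrow> real"
  assumes "continuous_on UNIV f" "\<forall>x. R \<le> norm x \<longrightarrow> f x = 0"
  shows "integrable lborel f"
proof -
  have "integrable lborel (\<lambda>x. indicator (cball 0 R) x *\<^sub>R f x)"
    by (intro borel_integrable_compact compact_cball continuous_on_subset[OF assms(1)]) simp
  moreover have "(\<lambda>x. indicator (cball 0 R) x *\<^sub>R f x) = f"
    using assms(2) by (auto simp: fun_eq_iff indicator_def)
  ultimately show ?thesis by simp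
qed

lemma mollifier_exists:
  assumes "r > 0"
  obtains \<rho> :: "real^'d \<Rightarrow> real" where "mollifier r \<rho>"
proof -
  \<comment> \<open>The bump \<open>exp (- 1 / (r\<^sup>2 - \<bar>x\<bar>\<^sup>2))\<close>, normalized by its integral.\<close>
  define q :: "real^'d \<Rightarrow> real" where "q x = r\<^sup>2 + (\<Sum>i\<in>UNIV. (-1) * (x $ i * x $ i))" for x
  have q_eq: "q x = r\<^sup>2 - (norm x)\<^sup>2" for x
    by (simp add: q_def power2_norm_eq_inner inner_vec_def sum_negf)
  have "smooth q"
    unfolding q_def by (intro smooth_add smooth_sum smooth_mult smooth_const smooth_component) simp
  define N :: "real poly \<Rightarrow> real poly" where "N p = [:0, 0, 1:] * (p - pderiv p)" for p
  define G where "G n = flat ((N ^^ n) 1)" for n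
  have "(G n has_field_derivative G (Suc n) t) (at t)" for n t
    using flat_has_derivative[of "(N ^^ n) 1" t, folded N_def] by (simp add: G_def)
  from smooth_compose[where G=G and n=0, OF \<open>smooth q\<close> this] have "smooth (\<lambda>x. G 0 (q x))" .
  then have sm: "smooth (\<lambda>x. flat 1 (q x))" by (simp add: G_def)
  have nn: "flat 1 (q x) \<ge> 0" for x by (simp add: flat_def)
  have z: "flat 1 (q x) = 0" if "r \<le> norm x" for x
  proof -
    have "r\<^sup>2 \<le> (norm x)\<^sup>2"
      using that \<open>r > 0\<close> by (intro power_mono) auto
    then have "\<not> q x > 0" unfolding q_eq by linarith
    then show ?thesis by (simp add: flat_def)
  qed
  have int: "integrable lborel (\<lambda>x. flat 1 (q x))"
    using continuous_vanishing_integrable[OF smooth_continuous[OF sm]] z by blast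
  have "(\<integral>x. flat 1 (q x) \<partial>lborel) \<noteq> 0"
  proof
    assume "(\<integral>x. flat 1 (q x) \<partial>lborel) = 0"
    then have ae: "AE x in lborel. flat 1 (q x) = 0"
      using integral_nonneg_eq_0_iff_AE[OF int] nn by simp
    have "x \<notin> ball 0 r" if "flat 1 (q x) = 0" for x
      using that power_strict_mono[of "norm x" r 2] by (auto simp: flat_def q_eq split: if_splits)
    with ae have "AE x in lborel. x \<notin> ball (0::real^'d) r" by (auto elim: eventually_mono)
    then have "negligible (ball (0::real^'d) r)"
      by (auto simp: negligible_iff_null_sets AE_iff_null_sets intro: AE_completion)
    then show False using \<open>r > 0\<close> by (simp add: open_not_negligible)
  qed
  moreover have "0 \<le> (\<integral>x. flat 1 (q x) \<partial>lborel)"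
    using nn by (intro Bochner_Integration.integral_nonneg) simp
  moreover define m where "m = (\<integral>x. flat 1 (q x) \<partial>lborel)"
  ultimately have m: "m > 0" by simp
  have "mollifier r (\<lambda>x. (1 / m) * flat 1 (q x))"
    unfolding mollifier_def
  proof (intro conjI allI impI)
    show "smooth (\<lambda>x. (1 / m) * flat 1 (q x))"
      by (intro smooth_mult smooth_const sm)
    show "(\<integral>x. (1 / m) * flat 1 (q x) \<partial>lborel) = 1"
      using m by (simp add: m_def[symmetric])
  qed (use m nn z in auto)
  then show ?thesis using that by blast
qed

section \<open>Convolution with a smooth kernel\<close>

lemma continuous_vanishing_uniformly_continuous:
  fixes f :: "'a::euclidean_space \<Rightarrow> 'b::real_normed_vector"
  assumes f: "continuous_on UNIV f" and z: "\<forall>x. R \<le> norm x \<longrightarrow> f x = 0" and "e > 0"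
  obtains d where "d > 0" "\<And>x y. norm (x - y) < d \<Longrightarrow> norm (f x - f y) < e"
proof -
  have "uniformly_continuous_on (cball 0 (R + 1)) f"
    using f by (intro compact_uniformly_continuous continuous_on_subset[OF f]) auto
  then obtain d where d: "d > 0"
      "\<And>x y. x \<in> cball 0 (R + 1) \<Longrightarrow> y \<in> cball 0 (R + 1) \<Longrightarrow> dist y x < d \<Longrightarrow> dist (f y) (f x) < e"
    unfolding uniformly_continuous_on_def using \<open>e > 0\<close> by meson
  show ?thesis
  proof
    show "min d 1 > 0" using d by simp
    fix x y :: 'a assume xy: "norm (x - y) < min d 1"
    show "norm (f x - f y) < e"
    proof (cases "norm x \<le> R + 1 \<and> norm y \<le> R + 1")
      case True
      then show ?thesis using d(2)[of y x] xy by (simp add: dist_norm)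
    next
      case False
      have "norm x \<le> norm y + norm (x - y)" "norm y \<le> norm x + norm (x - y)"
        using norm_triangle_sub[of x y] norm_triangle_sub[of y x] by (simp_all add: norm_minus_commute)
      then have "R \<le> norm x" "R \<le> norm y" using False xy by auto
      then show ?thesis using z \<open>e > 0\<close> by simp
    qed
  qed
qed

lemma continuous_vanishing_bounded:
  fixes f :: "'a::euclidean_space \<Rightarrow> 'b::real_normed_vector"
  assumes f: "continuous_on UNIV f" and z: "\<forall>x. R \<le> norm x \<longrightarrow> f x = 0"
  obtains B where "B \<ge> 0" "\<And>x. norm (f x) \<le> B"
proof -
  have "compact (f ` cball 0 R)"
    by (intro compact_continuous_image continuous_on_subset[OF f]) auto
  then obtain B where B: "\<And>x. x \<in> cball 0 R \<Longrightarrow> norm (f x) \<le> B"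
    using compact_imp_bounded bounded_iff by (metis image_eqI)
  have "norm (f x) \<le> max B 0" for x
    using B[of x] z[THEN spec, of x] by (cases "norm x \<le> R") auto
  then show ?thesis using that by (meson max.cobounded2)
qed

lemma smooth_partial_vanishing:
  assumes "\<forall>x. R \<le> norm x \<longrightarrow> f x = 0"
  shows "\<forall>x. R + 1 \<le> norm x \<longrightarrow> partial i f x = 0"
proof (intro allI impI)
  fix x :: "real^'a" assume "R + 1 \<le> norm x"
  show "partial i f x = 0"
  proof (rule partial_eq_0[where V="{x. R < norm x}"])
    show "open {x::real^'a. R < norm x}"
      by (intro open_Collect_less continuous_intros)
  qed (use assms \<open>R + 1 \<le> norm x\<close> in auto)
qed

text \<open>
  The convolution \<open>f * \<rho>\<close>. The integral is meaningful for \<open>f\<close> integrable and \<open>\<rho>\<close> continuous and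
  bounded, which is the only case considered.
\<close>

definition convolution :: "(real^'d \<Rightarrow> real) \<Rightarrow> (real^'d \<Rightarrow> real) \<Rightarrow> real^'d \<Rightarrow> real" where
  "convolution f \<rho> x = (\<integral>y. f y * \<rho> (x - y) \<partial>lborel)"

lemma convolution_integrable:
  fixes f :: "real^'d \<Rightarrow> real"
  assumes f: "integrable lborel f" and \<rho>: "continuous_on UNIV \<rho>" and B: "\<And>x. \<bar>\<rho> x\<bar> \<le> B"
  shows "integrable lborel (\<lambda>y. f y * \<rho> (x - y))"
proof (rule Bochner_Integration.integrable_bound)
  show "integrable lborel (\<lambda>y. B * \<bar>f y\<bar>)"
    using f by auto
  have "continuous_on UNIV (\<lambda>y. \<rho> (x - y))"
    by (rule continuous_on_compose2[OF \<rho>]) (auto intro!: continuous_intros)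
  then have [measurable]: "(\<lambda>y. \<rho> (x - y)) \<in> borel_measurable borel"
    by (rule borel_measurable_continuous_onI)
  show "(\<lambda>y. f y * \<rho> (x - y)) \<in> borel_measurable lborel"
    using f by measurable
  have "\<bar>f y\<bar> * \<bar>\<rho> (x - y)\<bar> \<le> \<bar>f y\<bar> * B" for y
    using B by (intro mult_left_mono) auto
  then show "AE y in lborel. norm (f y * \<rho> (x - y)) \<le> norm (B * \<bar>f y\<bar>)"
    using order_trans[OF abs_ge_zero B] by (auto simp: abs_mult mult.commute)
qed

text \<open>The first-order Taylor remainder is \<open>o(h)\<close> uniformly in the base point, because the gradient is
  uniformly continuous.\<close>

lemma smooth_linearization:
  fixes \<rho> :: "real^'d \<Rightarrow> real"
  assumes \<rho>: "smooth \<rho>" and z: "\<forall>x. R \<le> norm x \<longrightarrow> \<rho> x = 0" and "e > 0"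
  obtains d where "d > 0"
    "\<And>w h. norm h < d \<Longrightarrow> \<bar>\<rho> (w + h) - \<rho> w - grad \<rho> w \<bullet> h\<bar> \<le> e * norm h"
proof -
  have "\<forall>x. R + 1 \<le> norm x \<longrightarrow> grad \<rho> x = 0"
    using smooth_partial_vanishing[OF z] by (simp add: grad_def vec_eq_iff)
  from continuous_vanishing_uniformly_continuous[OF smooth_grad_continuous[OF \<rho>] this \<open>e > 0\<close>]
  obtain d where d: "d > 0" "\<And>x y. norm (x - y) < d \<Longrightarrow> norm (grad \<rho> x - grad \<rho> y) < e"
    by metis
  have "\<bar>\<rho> (w + h) - \<rho> w - grad \<rho> w \<bullet> h\<bar> \<le> e * norm h" if "norm h < d" for w h
  proof -
    have "norm (\<rho> (w + h) - \<rho> w - grad \<rho> w \<bullet> (w + h - w)) \<le> norm (w + h - w) * e"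
    proof (rule differentiable_bound_linearization[where S="ball w d" and f'="\<lambda>x h. grad \<rho> x \<bullet> h"])
      show "w + t *\<^sub>R (w + h - w) \<in> ball w d" if "t \<in> {0..1}" for t
        using that \<open>norm h < d\<close> mult_left_le_one_le[of "norm h" t] by (simp add: dist_norm)
      show "(\<rho> has_derivative (\<lambda>h. grad \<rho> x \<bullet> h)) (at x within ball w d)" for x
        using smooth_has_derivative[OF \<rho>] has_derivative_at_withinI by blast
      show "onorm ((\<lambda>h. grad \<rho> x \<bullet> h) - (\<lambda>h. grad \<rho> w \<bullet> h)) \<le> e" if "x \<in> ball w d" for x
      proof (rule onorm_le)
        fix v
        have "norm (((\<lambda>h. grad \<rho> x \<bullet> h) - (\<lambda>h. grad \<rho> w \<bullet> h)) v) = \<bar>(grad \<rho> x - grad \<rho> w) \<bullet> v\<bar>"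
          by (simp add: inner_diff_left)
        also have "\<dots> \<le> norm (grad \<rho> x - grad \<rho> w) * norm v"
          by (rule Cauchy_Schwarz_ineq2)
        also have "\<dots> \<le> e * norm v"
          using d(2)[of x w] that
          by (intro mult_right_mono) (auto simp: dist_norm norm_minus_commute)
        finally show "norm (((\<lambda>h. grad \<rho> x \<bullet> h) - (\<lambda>h. grad \<rho> w \<bullet> h)) v) \<le> e * norm v" .
      qed
    qed (use d in auto)
    then show ?thesis by (simp add: mult.commute)
  qed
  with d(1) that show ?thesis by blast
qed

lemma convolution_has_derivative:
  fixes f \<rho> :: "real^'d \<Rightarrow> real"
  assumes f: "integrable lborel f" and \<rho>: "smooth \<rho>" and z: "\<forall>x. R \<le> norm x \<longrightarrow> \<rho> x = 0"
  shows "(convolution f \<rho> has_derivative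
           (\<lambda>h. \<Sum>i\<in>UNIV. convolution f (partial i \<rho>) x * h $ i)) (at x)"
    (is "(_ has_derivative ?D) _")
  unfolding has_derivative_at_alt
proof (intro conjI allI impI)
  show "bounded_linear ?D"
    by (intro bounded_linear_sum bounded_linear_mult_right[THEN bounded_linear_compose]
        bounded_linear_vec_nth)
  obtain B where B: "\<And>x. \<bar>\<rho> x\<bar> \<le> B"
    using continuous_vanishing_bounded[OF smooth_continuous[OF \<rho>] z] by (metis real_norm_def)
  have I: "integrable lborel (\<lambda>y. f y * \<rho> (x - y))" for x
    using convolution_integrable[OF f smooth_continuous[OF \<rho>] B] .
  have IP: "integrable lborel (\<lambda>y. f y * partial i \<rho> (x - y))" for x i
  proof -
    obtain B where B: "\<And>x. \<bar>partial i \<rho> x\<bar> \<le> B"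
      using continuous_vanishing_bounded[OF smooth_continuous[OF smooth_partial[OF \<rho>]]
          smooth_partial_vanishing[OF z]]
      by (metis real_norm_def)
    then show ?thesis
      using convolution_integrable[OF f smooth_continuous[OF smooth_partial[OF \<rho>]]] by blast
  qed
  fix e :: real assume "e > 0"
  define M where "M = (\<integral>y. \<bar>f y\<bar> \<partial>lborel)"
  have "M \<ge> 0" by (simp add: M_def)
  define e' where "e' = e / (M + 1)"
  have "e' > 0" using \<open>e > 0\<close> \<open>M \<ge> 0\<close> by (simp add: e'_def)
  have "e' * M \<le> e" using \<open>e > 0\<close> \<open>M \<ge> 0\<close> by (simp add: e'_def field_simps)
  obtain d where d: "d > 0"
    "\<And>w h. norm h < d \<Longrightarrow> \<bar>\<rho> (w + h) - \<rho> w - grad \<rho> w \<bullet> h\<bar> \<le> e' * norm h"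
    using smooth_linearization[OF \<rho> z \<open>e' > 0\<close>] by metis
  show "\<exists>d>0. \<forall>y. norm (y - x) < d \<longrightarrow>
      norm (convolution f \<rho> y - convolution f \<rho> x - ?D (y - x)) \<le> e * norm (y - x)"
  proof (intro exI[of _ d] conjI allI impI d(1))
    fix t assume t: "norm (t - x) < d"
    define h where "h = t - x"
    have D: "f y * (grad \<rho> (x - y) \<bullet> h) = (\<Sum>i\<in>UNIV. f y * partial i \<rho> (x - y) * h $ i)" for y
      by (simp add: grad_def inner_vec_def sum_distrib_left mult.assoc)
    have ID: "integrable lborel (\<lambda>y. f y * (grad \<rho> (x - y) \<bullet> h))"
      unfolding D using IP by (intro Bochner_Integration.integrable_sum integrable_mult_left) auto
    have "?D h = (\<integral>y. f y * (grad \<rho> (x - y) \<bullet> h) \<partial>lborel)"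
      unfolding D convolution_def using IP by (subst Bochner_Integration.integral_sum) auto
    then have "convolution f \<rho> t - convolution f \<rho> x - ?D h
        = (\<integral>y. f y * \<rho> (t - y) - f y * \<rho> (x - y) - f y * (grad \<rho> (x - y) \<bullet> h) \<partial>lborel)"
      using I ID by (simp add: convolution_def)
    also have "\<bar>\<dots>\<bar> \<le> (\<integral>y. \<bar>f y\<bar> * (e' * norm h) \<partial>lborel)"
    proof (rule order_trans[OF integral_abs_bound] integral_mono)+
      show "integrable lborel (\<lambda>y. \<bar>f y * \<rho> (t - y) - f y * \<rho> (x - y) - f y * (grad \<rho> (x - y) \<bullet> h)\<bar>)"
        using I ID by (intro integrable_abs Bochner_Integration.integrable_diff) auto
      show "integrable lborel (\<lambda>y. \<bar>f y\<bar> * (e' * norm h))"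
        using f by auto
      fix y
      have "\<bar>f y * \<rho> (t - y) - f y * \<rho> (x - y) - f y * (grad \<rho> (x - y) \<bullet> h)\<bar>
          = \<bar>f y\<bar> * \<bar>\<rho> (x - y + h) - \<rho> (x - y) - grad \<rho> (x - y) \<bullet> h\<bar>"
        by (simp add: abs_mult[symmetric] h_def algebra_simps)
      also have "\<dots> \<le> \<bar>f y\<bar> * (e' * norm h)"
        using d(2)[of h "x - y"] t by (intro mult_left_mono) (auto simp: h_def)
      finally show "\<bar>f y * \<rho> (t - y) - f y * \<rho> (x - y) - f y * (grad \<rho> (x - y) \<bullet> h)\<bar>
          \<le> \<bar>f y\<bar> * (e' * norm h)" .
    qed
    also have "\<dots> = (e' * M) * norm h"
      by (simp add: M_def)
    also have "\<dots> \<le> e * norm h"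
      using \<open>e' * M \<le> e\<close> by (intro mult_right_mono) auto
    finally show "norm (convolution f \<rho> t - convolution f \<rho> x - ?D (t - x)) \<le> e * norm (t - x)"
      by (simp add: h_def)
  qed
qed

lemma partial_convolution:
  fixes f \<rho> :: "real^'d \<Rightarrow> real"
  assumes "integrable lborel f" "smooth \<rho>" "\<forall>x. R \<le> norm x \<longrightarrow> \<rho> x = 0"
  shows "partial i (convolution f \<rho>) = convolution f (partial i \<rho>)"
  by (rule ext)
    (simp add: partial_eq[OF convolution_has_derivative[OF assms]] axis_def if_distrib
      cong: if_cong)

text \<open>Derivatives fall on the kernel, so the convolutions of \<open>f\<close> with all smooth kernels of bounded
  support form a set that is stable under partial derivatives.\<close>

lemma smooth_convolution:
  fixes f \<rho> :: "real^'d \<Rightarrow> real"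
  assumes f: "integrable lborel f" and \<rho>: "smooth \<rho>" and z: "\<forall>x. R \<le> norm x \<longrightarrow> \<rho> x = 0"
  shows "smooth (convolution f \<rho>)"
proof (rule smooth_coinduct)
  let ?S = "{convolution f \<rho> | \<rho>. smooth \<rho> \<and> (\<exists>R. \<forall>x. R \<le> norm x \<longrightarrow> \<rho> x = 0)}"
  show "convolution f \<rho> \<in> ?S" using \<rho> z by blast
  show "g differentiable_on UNIV" if "g \<in> ?S" for g
    using that convolution_has_derivative[OF f]
    by (fastforce simp: differentiable_on_def differentiable_def)
  show "partial i g \<in> ?S" if gS: "g \<in> ?S" for g i
  proof -
    obtain \<rho> R where g: "g = convolution f \<rho>" "smooth \<rho>" and R: "\<forall>x. R \<le> norm x \<longrightarrow> \<rho> x = 0"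
      using gS by blast
    show ?thesis
      using partial_convolution[OF f g(2) R, of i] smooth_partial[OF g(2), of i]
        smooth_partial_vanishing[OF R, of i]
      unfolding g(1) by blast
  qed
qed

section \<open>Mollification in the space of square integrable functions\<close>

lemma lborel_distr_reflect: "distr lborel borel (\<lambda>y. x - y) = (lborel :: (real^'d) measure)"
proof -
  have "lborel = density (distr lborel borel (\<lambda>y. x + (-1) *\<^sub>R y)) (\<lambda>_. \<bar>-1::real\<bar> ^ DIM(real^'d))"
    by (rule lborel_affine) simp
  then show ?thesis by (simp add: density_1)
qed

lemma mollifier_continuous: "mollifier r \<rho> \<Longrightarrow> continuous_on S \<rho>"
  by (auto simp: mollifier_def intro: smooth_continuous)

lemma mollifier_measurable: "mollifier r \<rho> \<Longrightarrow> \<rho> \<in> borel_measurable borel"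
  by (simp add: borel_measurable_continuous_onI mollifier_continuous)

lemma mollifier_nonneg: "mollifier r \<rho> \<Longrightarrow> 0 \<le> \<rho> x"
  by (simp add: mollifier_def)

lemma mollifier_vanishing: "mollifier r \<rho> \<Longrightarrow> \<forall>x. r \<le> norm x \<longrightarrow> \<rho> x = 0"
  by (simp add: mollifier_def)

lemma mollifier_integrable: "mollifier r \<rho> \<Longrightarrow> integrable lborel \<rho>"
  using continuous_vanishing_integrable mollifier_continuous mollifier_vanishing by blast

lemma mollifier_reflect:
  assumes "mollifier r \<rho>"
  shows "integrable lborel (\<lambda>y. \<rho> (x - y))" "(\<integral>y. \<rho> (x - y) \<partial>lborel) = 1"
proof -
  have [measurable]: "\<rho> \<in> borel_measurable borel" using mollifier_measurable[OF assms] .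
  show "integrable lborel (\<lambda>y. \<rho> (x - y))"
    using mollifier_integrable[OF assms] integrable_distr_eq[of "\<lambda>y. x - y" lborel borel \<rho>]
    by (simp add: lborel_distr_reflect)
  show "(\<integral>y. \<rho> (x - y) \<partial>lborel) = 1"
    using integral_distr[of "\<lambda>y. x - y" lborel borel \<rho>] assms
    by (simp add: lborel_distr_reflect mollifier_def)
qed

lemma mollifier_nn_integral_shift:
  assumes "mollifier r \<rho>"
  shows "(\<integral>\<^sup>+x. ennreal (\<rho> (x - y)) \<partial>lborel) = 1"
proof -
  have [measurable]: "\<rho> \<in> borel_measurable borel" using mollifier_measurable[OF assms] .
  have "(\<integral>\<^sup>+x. ennreal (\<rho> (x - y)) \<partial>lborel) = (\<integral>\<^sup>+x. ennreal (\<rho> x) \<partial>lborel)"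
    by (subst lborel_distr_plus[of "-y", symmetric]) (simp add: nn_integral_distr)
  also have "\<dots> = ennreal (\<integral>x. \<rho> x \<partial>lborel)"
    using mollifier_integrable[OF assms] mollifier_nonneg[OF assms]
    by (intro nn_integral_eq_integral) auto
  finally show ?thesis using assms by (simp add: mollifier_def)
qed

lemma mollifier_convolution_integrable:
  assumes "integrable lborel f" "mollifier r \<rho>"
  shows "integrable lborel (\<lambda>y. f y * \<rho> (x - y))"
proof -
  obtain B where "\<And>x. \<bar>\<rho> x\<bar> \<le> B"
    using continuous_vanishing_bounded[OF mollifier_continuous[OF assms(2)]
        mollifier_vanishing[OF assms(2)]] by (metis real_norm_def)
  then show ?thesis
    using convolution_integrable[OF assms(1) mollifier_continuous[OF assms(2)]] by blast
qed

lemma smooth_mollify: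
  assumes "integrable lborel f" "mollifier r \<rho>" shows "smooth (convolution f \<rho>)"
  using smooth_convolution assms unfolding mollifier_def by blast

lemma convolution_measurable:
  assumes "integrable lborel f" "mollifier r \<rho>"
  shows "convolution f \<rho> \<in> borel_measurable borel"
  by (intro borel_measurable_continuous_onI smooth_continuous smooth_mollify[OF assms])

lemma convolution_bounded:
  assumes f: "integrable lborel f" and C: "\<And>x. \<bar>f x\<bar> \<le> C" and \<rho>: "mollifier r \<rho>"
  shows "\<bar>convolution f \<rho> x\<bar> \<le> C"
proof -
  have "\<bar>convolution f \<rho> x\<bar> \<le> (\<integral>y. C * \<rho> (x - y) \<partial>lborel)"
    unfolding convolution_def
  proof (rule order_trans[OF integral_abs_bound] integral_mono)+
    show "integrable lborel (\<lambda>y. \<bar>f y * \<rho> (x - y)\<bar>)"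
      using mollifier_convolution_integrable[OF f \<rho>] by auto
    show "integrable lborel (\<lambda>y. C * \<rho> (x - y))"
      using mollifier_reflect[OF \<rho>] by auto
    show "\<bar>f y * \<rho> (x - y)\<bar> \<le> C * \<rho> (x - y)" for y
      using C mollifier_nonneg[OF \<rho>] by (simp add: abs_mult mult_right_mono)
  qed
  then show ?thesis using mollifier_reflect[OF \<rho>] by simp
qed

text \<open>Jensen's inequality for the probability density \<open>y \<mapsto> \<rho> (x - y)\<close>: the variance is
  nonnegative.\<close>

lemma convolution_power2_le:
  assumes f: "integrable lborel f" "integrable lborel (\<lambda>x. (f x)\<^sup>2)" and \<rho>: "mollifier r \<rho>"
  shows "(convolution f \<rho> x)\<^sup>2 \<le> (\<integral>y. (f y)\<^sup>2 * \<rho> (x - y) \<partial>lborel)"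
proof -
  define m where "m = convolution f \<rho> x"
  have "0 \<le> (\<integral>y. (f y - m)\<^sup>2 * \<rho> (x - y) \<partial>lborel)"
    using mollifier_nonneg[OF \<rho>] by (intro integral_nonneg_AE) auto
  also have "\<dots> = (\<integral>y. (f y)\<^sup>2 * \<rho> (x - y) - 2 * m * (f y * \<rho> (x - y)) + m\<^sup>2 * \<rho> (x - y) \<partial>lborel)"
    by (intro Bochner_Integration.integral_cong) (auto simp: power2_eq_square algebra_simps)
  also have "\<dots> = (\<integral>y. (f y)\<^sup>2 * \<rho> (x - y) \<partial>lborel) - 2 * m * m + m\<^sup>2 * 1"
    using mollifier_convolution_integrable[OF f(1) \<rho>, of x]
      mollifier_convolution_integrable[OF f(2) \<rho>, of x] mollifier_reflect[OF \<rho>, of x]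
    by (simp add: m_def convolution_def)
  finally show ?thesis by (simp add: m_def power2_eq_square)
qed

lemma convolution_L2_contraction:
  assumes f: "integrable lborel f" "integrable lborel (\<lambda>x. (f x)\<^sup>2)" and \<rho>: "mollifier r \<rho>"
  shows "integrable lborel (\<lambda>x. (convolution f \<rho> x)\<^sup>2)"
    and "(\<integral>x. (convolution f \<rho> x)\<^sup>2 \<partial>lborel) \<le> (\<integral>x. (f x)\<^sup>2 \<partial>lborel)"
proof -
  have [measurable]: "\<rho> \<in> borel_measurable borel" "f \<in> borel_measurable borel"
    using mollifier_measurable[OF \<rho>] f by auto
  have "(\<integral>\<^sup>+x. ennreal ((convolution f \<rho> x)\<^sup>2) \<partial>lborel)
      \<le> (\<integral>\<^sup>+x. (\<integral>\<^sup>+y. ennreal ((f y)\<^sup>2 * \<rho> (x - y)) \<partial>lborel) \<partial>lborel)"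
  proof (rule nn_integral_mono)
    fix x
    have "(\<integral>\<^sup>+y. ennreal ((f y)\<^sup>2 * \<rho> (x - y)) \<partial>lborel) = ennreal (\<integral>y. (f y)\<^sup>2 * \<rho> (x - y) \<partial>lborel)"
      using mollifier_convolution_integrable[OF f(2) \<rho>] mollifier_nonneg[OF \<rho>]
      by (intro nn_integral_eq_integral) auto
    then show "ennreal ((convolution f \<rho> x)\<^sup>2) \<le> (\<integral>\<^sup>+y. ennreal ((f y)\<^sup>2 * \<rho> (x - y)) \<partial>lborel)"
      using convolution_power2_le[OF f \<rho>] by (simp add: ennreal_leI)
  qed
  also have "\<dots> = (\<integral>\<^sup>+y. (\<integral>\<^sup>+x. ennreal ((f y)\<^sup>2 * \<rho> (x - y)) \<partial>lborel) \<partial>lborel)"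
    by (rule lborel_pair.Fubini') measurable
  also have "\<dots> = (\<integral>\<^sup>+y. ennreal ((f y)\<^sup>2) * (\<integral>\<^sup>+x. ennreal (\<rho> (x - y)) \<partial>lborel) \<partial>lborel)"
    using mollifier_nonneg[OF \<rho>] by (simp add: ennreal_mult nn_integral_cmult)
  also have "\<dots> = ennreal (\<integral>y. (f y)\<^sup>2 \<partial>lborel)"
    using f by (simp add: mollifier_nn_integral_shift[OF \<rho>] nn_integral_eq_integral)
  finally have le: "(\<integral>\<^sup>+x. ennreal ((convolution f \<rho> x)\<^sup>2) \<partial>lborel) \<le> ennreal (\<integral>y. (f y)\<^sup>2 \<partial>lborel)" .
  have [measurable]: "convolution f \<rho> \<in> borel_measurable borel"
    using convolution_measurable[OF f(1) \<rho>] .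
  show i: "integrable lborel (\<lambda>x. (convolution f \<rho> x)\<^sup>2)"
    using le by (intro integrableI_nonneg) (auto simp: less_top[symmetric] top_unique)
  show "(\<integral>x. (convolution f \<rho> x)\<^sup>2 \<partial>lborel) \<le> (\<integral>x. (f x)\<^sup>2 \<partial>lborel)"
    using le nn_integral_eq_integral[OF i] by simp
qed

lemma mollify_continuous_L2:
  fixes g :: "real^'d \<Rightarrow> real"
  assumes g: "continuous_on UNIV g" and z: "\<forall>x. R \<le> norm x \<longrightarrow> g x = 0" and "e > 0"
  obtains d where "d > 0" "\<And>r \<rho>. r < d \<Longrightarrow> mollifier r \<rho> \<Longrightarrow>
    integrable lborel (\<lambda>x. (convolution g \<rho> x - g x)\<^sup>2) \<and>
    (\<integral>x. (convolution g \<rho> x - g x)\<^sup>2 \<partial>lborel) < e"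
proof -
  define V where "V = measure lborel (cball (0::real^'d) (R + 1))"
  define a where "a = sqrt (e / (V + 1))"
  have "V \<ge> 0" by (simp add: V_def)
  then have "a > 0" using \<open>e > 0\<close> by (simp add: a_def)
  have "a\<^sup>2 * V < e" using \<open>e > 0\<close> \<open>V \<ge> 0\<close> by (simp add: a_def field_simps)
  have intg: "integrable lborel g" using continuous_vanishing_integrable[OF g z] .
  obtain d where d: "d > 0" "\<And>x y. norm (x - y) < d \<Longrightarrow> norm (g x - g y) < a"
    using continuous_vanishing_uniformly_continuous[OF g z \<open>a > 0\<close>] by metis
  show ?thesis
  proof
    show "min d 1 > 0" using d by simp
    fix r :: real and \<rho> :: "real^'d \<Rightarrow> real" assume r: "r < min d 1" and \<rho>: "mollifier r \<rho>"
    have le: "\<bar>convolution g \<rho> x - g x\<bar> \<le> a" for x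
    proof -
      have "convolution g \<rho> x - g x = (\<integral>y. g y * \<rho> (x - y) - g x * \<rho> (x - y) \<partial>lborel)"
        using mollifier_convolution_integrable[OF intg \<rho>] mollifier_reflect[OF \<rho>]
        by (simp add: convolution_def)
      also have "\<bar>\<dots>\<bar> \<le> (\<integral>y. a * \<rho> (x - y) \<partial>lborel)"
      proof (rule order_trans[OF integral_abs_bound] integral_mono)+
        show "integrable lborel (\<lambda>y. \<bar>g y * \<rho> (x - y) - g x * \<rho> (x - y)\<bar>)"
          using mollifier_convolution_integrable[OF intg \<rho>] mollifier_reflect[OF \<rho>]
          by (intro integrable_abs Bochner_Integration.integrable_diff) auto
        show "integrable lborel (\<lambda>y. a * \<rho> (x - y))"
          using mollifier_reflect[OF \<rho>] by auto
        fix y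
        show "\<bar>g y * \<rho> (x - y) - g x * \<rho> (x - y)\<bar> \<le> a * \<rho> (x - y)"
        proof (cases "norm (x - y) < r")
          case True
          then have "\<bar>g y - g x\<bar> * \<rho> (x - y) \<le> a * \<rho> (x - y)"
            using d(2)[of y x] r mollifier_nonneg[OF \<rho>]
            by (intro mult_right_mono) (auto simp: norm_minus_commute)
          then show ?thesis
            using mollifier_nonneg[OF \<rho>] by (simp add: left_diff_distrib[symmetric] abs_mult)
        qed (use mollifier_vanishing[OF \<rho>] in auto)
      qed
      finally show ?thesis using mollifier_reflect[OF \<rho>] by simp
    qed
    have "convolution g \<rho> x - g x = 0" if "R + 1 < norm x" for x
    proof -
      have "(\<lambda>y. g y * \<rho> (x - y)) = (\<lambda>y. 0)"
      proof
        fix y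
        show "g y * \<rho> (x - y) = 0"
          using z[THEN spec, of y] mollifier_vanishing[OF \<rho>, THEN spec, of "x - y"] norm_triangle_sub[of x y] r that
          by (cases "R \<le> norm y") auto
      qed
      then show ?thesis using that z[THEN spec, of x] unfolding convolution_def by simp
    qed
    then have bd: "(convolution g \<rho> x - g x)\<^sup>2 \<le> a\<^sup>2 * indicator (cball 0 (R + 1)) x" for x
      using le[of x] power_mono[OF le[of x], of 2] by (auto simp: indicator_def)
    have i: "integrable lborel (\<lambda>x. a\<^sup>2 * indicator (cball (0::real^'d) (R + 1)) x)"
      by (intro integrable_mult_right integrable_real_indicator)
        (use emeasure_compact_finite[OF compact_cball, of "0::real^'d" "R + 1"] in auto)
    have [measurable]: "convolution g \<rho> \<in> borel_measurable borel" "g \<in> borel_measurable borel"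
      using convolution_measurable[OF intg \<rho>] intg by auto
    have j: "integrable lborel (\<lambda>x. (convolution g \<rho> x - g x)\<^sup>2)"
      by (rule Bochner_Integration.integrable_bound[OF i]) (use bd in auto)
    have "(\<integral>x. (convolution g \<rho> x - g x)\<^sup>2 \<partial>lborel)
        \<le> (\<integral>x. a\<^sup>2 * indicator (cball (0::real^'d) (R + 1)) x \<partial>lborel)"
      by (intro integral_mono i j bd)
    also have "\<dots> = a\<^sup>2 * V" by (simp add: V_def)
    finally show "integrable lborel (\<lambda>x. (convolution g \<rho> x - g x)\<^sup>2) \<and>
        (\<integral>x. (convolution g \<rho> x - g x)\<^sup>2 \<partial>lborel) < e"
      using j \<open>a\<^sup>2 * V < e\<close> by simp
  qed
qed

lemma power2_add_le: "(a + b)\<^sup>2 \<le> 2 * a\<^sup>2 + 2 * (b::real)\<^sup>2"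
  using zero_le_power2[of "a - b"] by (simp add: power2_eq_square algebra_simps)

text \<open>Continuous functions with compact support are dense: truncate the values of \<open>f\<close>, then truncate
  and cut off a sequence of continuous functions that converges to \<open>f\<close> almost everywhere.\<close>

lemma L2_dense_continuous:
  fixes f :: "real^'d \<Rightarrow> real"
  assumes f: "integrable lborel (\<lambda>x. (f x)\<^sup>2)" and [measurable]: "f \<in> borel_measurable borel"
    and z: "\<forall>x. R \<le> norm x \<longrightarrow> f x = 0" and "e > 0"
  obtains g where "continuous_on UNIV g" "\<forall>x. R + 1 \<le> norm x \<longrightarrow> g x = 0"
    "integrable lborel (\<lambda>x. (f x - g x)\<^sup>2)" "(\<integral>x. (f x - g x)\<^sup>2 \<partial>lborel) < e"
proof -
  define clip :: "real \<Rightarrow> real \<Rightarrow> real" where "clip M t = max (- M) (min M t)" for M t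
  have clip_meas [measurable]: "clip M \<in> borel_measurable borel" for M
    unfolding clip_def by measurable
  have clip_cont: "continuous_on UNIV (clip M)" for M
    unfolding clip_def by (intro continuous_intros)
  have "(\<lambda>n. \<integral>x. (f x - clip (real n) (f x))\<^sup>2 \<partial>lborel) \<longlonglongrightarrow> (\<integral>x. 0 \<partial>(lborel :: (real^'d) measure))"
  proof (rule integral_dominated_convergence)
    show "integrable lborel (\<lambda>x. (f x)\<^sup>2)" by (rule f)
    show "AE x in lborel. (\<lambda>n. (f x - clip (real n) (f x))\<^sup>2) \<longlonglongrightarrow> 0"
    proof (rule AE_I2, rule tendsto_eventually)
      fix x
      show "\<forall>\<^sub>F n in sequentially. (f x - clip (real n) (f x))\<^sup>2 = 0"
        using eventually_ge_at_top[of "nat \<lceil>\<bar>f x\<bar>\<rceil>"]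
      proof eventually_elim
        case (elim n)
        then have "\<bar>f x\<bar> \<le> real n" by linarith
        then show ?case by (auto simp: clip_def)
      qed
    qed
    have "\<bar>f x - clip (real n) (f x)\<bar> \<le> \<bar>f x\<bar>" for x n by (auto simp: clip_def)
    then show "AE x in lborel. norm ((f x - clip (real n) (f x))\<^sup>2) \<le> (f x)\<^sup>2" for n
      by (simp add: abs_le_square_iff)
  qed measurable
  then have "\<forall>\<^sub>F n in sequentially. (\<integral>x. (f x - clip (real n) (f x))\<^sup>2 \<partial>lborel) < e / 4"
    using \<open>e > 0\<close> by (intro order_tendstoD(2)) auto
  then obtain m where m: "(\<integral>x. (f x - clip (real m) (f x))\<^sup>2 \<partial>lborel) < e / 4"
    by (auto simp: eventually_sequentially)
  define M where "M = real m"
  have clip_le: "\<bar>clip M t\<bar> \<le> M" for t by (auto simp: clip_def M_def)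
  have i1: "integrable lborel (\<lambda>x. (f x - clip M (f x))\<^sup>2)"
  proof (rule Bochner_Integration.integrable_bound[OF f])
    have "\<bar>f x - clip M (f x)\<bar> \<le> \<bar>f x\<bar>" for x by (auto simp: clip_def M_def)
    then show "AE x in lborel. norm ((f x - clip M (f x))\<^sup>2) \<le> norm ((f x)\<^sup>2)"
      by (simp add: abs_le_square_iff)
  qed measurable
  have "f \<in> borel_measurable lebesgue" by (simp add: measurable_completion)
  then have "f measurable_on UNIV" by (rule lebesgue_measurable_imp_measurable_on) simp
  then obtain N g where N: "negligible N" and g: "\<And>n. continuous_on UNIV (g n)"
    and lim: "\<And>x. x \<notin> N \<Longrightarrow> (\<lambda>n. g n x) \<longlonglongrightarrow> f x"
    unfolding measurable_on_def by auto
  define \<kappa> :: "real^'d \<Rightarrow> real" where "\<kappa> x = max 0 (min 1 (R + 1 - norm x))" for x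
  define h where "h n x = \<kappa> x * clip M (g n x)" for n x
  have h_cont: "continuous_on UNIV (h n)" for n
    unfolding h_def \<kappa>_def
    by (intro continuous_intros continuous_on_compose2[OF clip_cont] g) auto
  have [measurable]: "h n \<in> borel_measurable borel" for n
    by (rule borel_measurable_continuous_onI[OF h_cont])
  have h_z: "\<forall>x. R + 1 \<le> norm x \<longrightarrow> h n x = 0" for n
    by (simp add: h_def \<kappa>_def)
  have fz: "clip M (f x) = \<kappa> x * clip M (f x)" for x
    using z[THEN spec, of x] by (cases "norm x \<le> R") (auto simp: \<kappa>_def clip_def M_def)
  have bd: "(clip M (f x) - h n x)\<^sup>2 \<le> (2 * M)\<^sup>2 * indicator (cball 0 (R + 1)) x" for n x
  proof (cases "norm x \<le> R + 1")
    case True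
    have "\<bar>\<kappa> x\<bar> * \<bar>clip M (g n x)\<bar> \<le> 1 * M"
      using clip_le by (intro mult_mono) (auto simp: \<kappa>_def)
    then have "\<bar>clip M (f x) - h n x\<bar> \<le> 2 * M"
      using clip_le[of "f x"] unfolding h_def abs_mult[symmetric] by linarith
    then have "(clip M (f x) - h n x)\<^sup>2 \<le> (2 * M)\<^sup>2"
      using power_mono[of "\<bar>clip M (f x) - h n x\<bar>" "2 * M" 2] by simp
    then show ?thesis using True by simp
  next
    case False
    then show ?thesis using h_z[THEN spec, of x n] fz[of x] by (simp add: \<kappa>_def)
  qed
  have i: "integrable lborel (\<lambda>x. (2 * M)\<^sup>2 * indicator (cball (0::real^'d) (R + 1)) x)"
    by (intro integrable_mult_right integrable_real_indicator)
        (use emeasure_compact_finite[OF compact_cball, of "0::real^'d" "R + 1"] in auto)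
  have i2: "integrable lborel (\<lambda>x. (clip M (f x) - h n x)\<^sup>2)" for n
    by (rule Bochner_Integration.integrable_bound[OF i]) (use bd in auto)
  have "(\<lambda>n. \<integral>x. (clip M (f x) - h n x)\<^sup>2 \<partial>lborel) \<longlonglongrightarrow> (\<integral>x. 0 \<partial>(lborel :: (real^'d) measure))"
  proof (rule integral_dominated_convergence)
    show "integrable lborel (\<lambda>x. (2 * M)\<^sup>2 * indicator (cball (0::real^'d) (R + 1)) x)" by (rule i)
    have "AE x in lebesgue. x \<notin> N"
      using N by (simp add: negligible_iff_null_sets AE_not_in)
    then have "AE x in lborel. x \<notin> N" by (simp add: AE_completion_iff)
    then show "AE x in lborel. (\<lambda>n. (clip M (f x) - h n x)\<^sup>2) \<longlonglongrightarrow> 0"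
    proof eventually_elim
      case (elim x)
      have "(\<lambda>n. (clip M (f x) - \<kappa> x * clip M (g n x))\<^sup>2)
          \<longlonglongrightarrow> (clip M (f x) - \<kappa> x * clip M (f x))\<^sup>2"
        using lim[OF elim] unfolding clip_def by (intro tendsto_intros)
      then show ?case using fz[of x] by (simp add: h_def)
    qed
    show "AE x in lborel. norm ((clip M (f x) - h n x)\<^sup>2)
        \<le> (2 * M)\<^sup>2 * indicator (cball 0 (R + 1)) x" for n
      using bd by simp
  qed measurable
  then have "\<forall>\<^sub>F n in sequentially. (\<integral>x. (clip M (f x) - h n x)\<^sup>2 \<partial>lborel) < e / 4"
    using \<open>e > 0\<close> by (intro order_tendstoD(2)) auto
  then obtain n where n: "(\<integral>x. (clip M (f x) - h n x)\<^sup>2 \<partial>lborel) < e / 4"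
    by (auto simp: eventually_sequentially)
  let ?b = "\<lambda>x. 2 * (f x - clip M (f x))\<^sup>2 + 2 * (clip M (f x) - h n x)\<^sup>2"
  have le: "(f x - h n x)\<^sup>2 \<le> ?b x" for x
    using power2_add_le[of "f x - clip M (f x)" "clip M (f x) - h n x"] by simp
  have ib: "integrable lborel ?b" using i1 i2 by auto
  have ih: "integrable lborel (\<lambda>x. (f x - h n x)\<^sup>2)"
  proof (rule Bochner_Integration.integrable_bound[OF ib])
    show "AE x in lborel. norm ((f x - h n x)\<^sup>2) \<le> norm (?b x)"
      by (intro AE_I2) (simp only: real_norm_def abs_power2 order_trans[OF le abs_ge_self])
  qed measurable
  have "(\<integral>x. (f x - h n x)\<^sup>2 \<partial>lborel) \<le> (\<integral>x. ?b x \<partial>lborel)"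
    by (intro integral_mono ih ib le)
  also have "\<dots> < e"
    using m n i1 i2 by (simp add: M_def)
  finally have lt: "(\<integral>x. (f x - h n x)\<^sup>2 \<partial>lborel) < e" .
  show ?thesis by (rule that[of "h n", OF h_cont h_z ih lt])
qed

text \<open>Density and contraction extend the convergence from continuous functions to \<open>L\<^sup>2\<close>.\<close>

lemma mollify_L2:
  fixes f :: "real^'d \<Rightarrow> real"
  assumes f: "integrable lborel f" "integrable lborel (\<lambda>x. (f x)\<^sup>2)"
    and z: "\<forall>x. R \<le> norm x \<longrightarrow> f x = 0" and "e > 0"
  obtains d where "d > 0" "\<And>r \<rho>. r < d \<Longrightarrow> mollifier r \<rho> \<Longrightarrow>
    integrable lborel (\<lambda>x. (convolution f \<rho> x - f x)\<^sup>2) \<and>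
    (\<integral>x. (convolution f \<rho> x - f x)\<^sup>2 \<partial>lborel) < e"
proof -
  have [measurable]: "f \<in> borel_measurable borel" using f by simp
  have e': "e / 12 > 0" using \<open>e > 0\<close> by simp
  obtain g where g: "continuous_on UNIV g" and gz: "\<forall>x. R + 1 \<le> norm x \<longrightarrow> g x = 0"
    and gi: "integrable lborel (\<lambda>x. (f x - g x)\<^sup>2)" and ge: "(\<integral>x. (f x - g x)\<^sup>2 \<partial>lborel) < e / 12"
    by (rule L2_dense_continuous[OF f(2) \<open>f \<in> borel_measurable borel\<close> z e'])
  have ig: "integrable lborel g" using continuous_vanishing_integrable[OF g gz] .
  obtain d where d: "d > 0" "\<And>r \<rho>. r < d \<Longrightarrow> mollifier r \<rho> \<Longrightarrow>
      integrable lborel (\<lambda>x. (convolution g \<rho> x - g x)\<^sup>2) \<and>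
      (\<integral>x. (convolution g \<rho> x - g x)\<^sup>2 \<partial>lborel) < e / 12"
    using mollify_continuous_L2[OF g gz e'] by blast
  show ?thesis
  proof (rule that[OF d(1)])
    fix r :: real and \<rho> :: "real^'d \<Rightarrow> real" assume r: "r < d" and \<rho>: "mollifier r \<rho>"
    let ?k = "\<lambda>x. f x - g x"
    have ik: "integrable lborel ?k" using f ig by simp
    note con = convolution_L2_contraction[OF ik gi \<rho>] and gg = d(2)[OF r \<rho>]
    have sp: "convolution ?k \<rho> x = convolution f \<rho> x - convolution g \<rho> x" for x
      using mollifier_convolution_integrable[OF f(1) \<rho>] mollifier_convolution_integrable[OF ig \<rho>]
      by (simp add: convolution_def left_diff_distrib)
    let ?b = "\<lambda>x. 4 * (convolution ?k \<rho> x)\<^sup>2 + 4 * (convolution g \<rho> x - g x)\<^sup>2 + 2 * (?k x)\<^sup>2"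
    have le: "(convolution f \<rho> x - f x)\<^sup>2 \<le> ?b x" for x
    proof -
      have eq: "convolution f \<rho> x - f x = (convolution ?k \<rho> x + (convolution g \<rho> x - g x)) + - ?k x"
        unfolding sp by linarith
      show ?thesis
        unfolding eq using power2_add_le[of "convolution ?k \<rho> x + (convolution g \<rho> x - g x)" "- ?k x"]
          power2_add_le[of "convolution ?k \<rho> x" "convolution g \<rho> x - g x"]
        unfolding power2_minus by linarith
    qed
    have ib: "integrable lborel ?b"
      using con(1) gg gi by (intro Bochner_Integration.integrable_add integrable_mult_right) auto
    have [measurable]: "convolution f \<rho> \<in> borel_measurable borel"
      using convolution_measurable[OF f(1) \<rho>] .
    have i: "integrable lborel (\<lambda>x. (convolution f \<rho> x - f x)\<^sup>2)"
    proof (rule Bochner_Integration.integrable_bound[OF ib])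
      show "AE x in lborel. norm ((convolution f \<rho> x - f x)\<^sup>2) \<le> norm (?b x)"
        by (intro AE_I2) (simp only: real_norm_def abs_power2 order_trans[OF le abs_ge_self])
    qed measurable
    have "(\<integral>x. (convolution f \<rho> x - f x)\<^sup>2 \<partial>lborel) \<le> (\<integral>x. ?b x \<partial>lborel)"
      by (intro integral_mono i ib le)
    also have "\<dots> = 4 * (\<integral>x. (convolution ?k \<rho> x)\<^sup>2 \<partial>lborel)
        + 4 * (\<integral>x. (convolution g \<rho> x - g x)\<^sup>2 \<partial>lborel) + 2 * (\<integral>x. (?k x)\<^sup>2 \<partial>lborel)"
      using con(1) gg gi by (simp del: integral_diff)
    also have "\<dots> < e" using con(2) gg[THEN conjunct2] ge \<open>e > 0\<close> by linarith
    finally show "integrable lborel (\<lambda>x. (convolution f \<rho> x - f x)\<^sup>2) \<and>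
        (\<integral>x. (convolution f \<rho> x - f x)\<^sup>2 \<partial>lborel) < e"
      using i by simp
  qed
qed

section \<open>Smooth approximation of bounded Sobolev functions\<close>

lemma component_measurable:
  fixes g :: "'a \<Rightarrow> real^'d"
  assumes "g \<in> borel_measurable M" shows "(\<lambda>x. g x $ i) \<in> borel_measurable M"
  using borel_measurable_continuous_on[OF _ assms, of "\<lambda>v. v $ i"]
  by (simp add: continuous_on_component)

lemma borel_representative:
  fixes f :: "real^'d \<Rightarrow> real"
  assumes f: "f \<in> borel_measurable (lebesgue_on U)" and U: "open U"
  obtains g where "g \<in> borel_measurable borel" "\<forall>x. x \<notin> U \<longrightarrow> g x = 0"
    "AE x in lebesgue_on U. g x = f x"
proof -
  have Ul: "U \<in> sets lebesgue" and Ub: "U \<in> sets borel" using U by auto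
  have "(\<lambda>x. if x \<in> U then f x else 0) \<in> borel_measurable lebesgue"
    using borel_measurable_if_I[OF f Ul] .
  then obtain h where h: "h \<in> borel_measurable lborel"
    and ae: "AE x in lborel. (if x \<in> U then f x else 0) = h x"
    using completion_ex_borel_measurable_real by blast
  define g where "g x = indicator U x * h x" for x
  have [measurable]: "h \<in> borel_measurable borel" "U \<in> sets borel" using h Ub by auto
  have 1: "g \<in> borel_measurable borel" unfolding g_def by measurable
  have "AE x in lebesgue. (if x \<in> U then f x else 0) = h x"
    using ae by (rule AE_completion)
  then have "AE x in lebesgue. x \<in> U \<longrightarrow> g x = f x"
    by eventually_elim (auto simp: g_def)
  then have "AE x in lebesgue_on U. g x = f x"
    using Ul by (simp add: AE_restrict_space_iff)
  with 1 that[of g] show ?thesis by (simp add: g_def)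
qed

lemma lebesgue_on_eq_lborel:
  fixes F :: "real^'d \<Rightarrow> real"
  assumes F: "F \<in> borel_measurable borel" and z: "\<forall>x. x \<notin> U \<longrightarrow> F x = 0" and U: "open U"
  shows "integral\<^sup>L (lebesgue_on U) F = integral\<^sup>L lborel F"
    and "integrable (lebesgue_on U) F \<longleftrightarrow> integrable lborel F"
proof -
  have Ul: "U \<in> sets lebesgue" using U by auto
  then have sp: "U \<inter> space lebesgue \<in> sets lebesgue" by simp
  have eq: "(\<lambda>x. indicator U x *\<^sub>R F x) = F"
    using z by (auto simp: fun_eq_iff indicator_def)
  show "integral\<^sup>L (lebesgue_on U) F = integral\<^sup>L lborel F"
    unfolding integral_restrict_space[OF sp] eq by (rule integral_completion) (use F in simp)
  show "integrable (lebesgue_on U) F \<longleftrightarrow> integrable lborel F"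
    unfolding integrable_restrict_space[OF sp] eq by (rule integrable_completion) (use F in simp)
qed

lemma weak_grad_L2:
  assumes "u \<in> H12 U"
  shows "weak_grad U u \<in> L2 U" and "has_weak_gradient U u (weak_grad U u)"
proof -
  have "\<exists>g. g \<in> L2 U \<and> has_weak_gradient U u g" using assms by (auto simp: H12_def)
  from someI_ex[OF this]
  show "weak_grad U u \<in> L2 U" "has_weak_gradient U u (weak_grad U u)"
    by (auto simp: weak_grad_def)
qed

lemma test_functions_smooth: "\<psi> \<in> test_functions U \<Longrightarrow> smooth \<psi>"
  by (simp add: test_functions_def)

lemma test_functions_vanishing:
  assumes "\<psi> \<in> test_functions U" "x \<notin> closure {x. \<psi> x \<noteq> 0}"
  shows "\<psi> x = 0" "partial i \<psi> x = 0"
proof -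
  have z: "\<psi> y = 0" if "y \<in> - closure {x. \<psi> x \<noteq> 0}" for y
    using that closure_subset[of "{x. \<psi> x \<noteq> 0}"] by auto
  show "\<psi> x = 0" by (rule z) (use assms(2) in blast)
  show "partial i \<psi> x = 0"
    by (rule partial_eq_0[OF open_Compl[OF closed_closure] _ z]) (use assms(2) in blast)+
qed

lemma test_functions_mult:
  assumes "\<psi> \<in> test_functions U" "smooth g"
  shows "(\<lambda>x. g x * \<psi> x) \<in> test_functions U"
proof -
  have sub: "closure {x. g x * \<psi> x \<noteq> 0} \<subseteq> closure {x. \<psi> x \<noteq> 0}"
    by (rule closure_mono) auto
  have cmp: "compact (closure {x. \<psi> x \<noteq> 0})" "closure {x. \<psi> x \<noteq> 0} \<subseteq> U"
    using assms by (auto simp: test_functions_def)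
  have "compact (closure {x. g x * \<psi> x \<noteq> 0})"
    using compact_Int_closed[OF cmp(1) closed_closure[of "{x. g x * \<psi> x \<noteq> 0}"]] sub
    by (simp add: Int_absorb1)
  then show ?thesis
    using sub cmp(2) smooth_mult[OF assms(2) test_functions_smooth[OF assms(1)]]
    by (auto simp: test_functions_def)
qed

lemma mollifier_reflect_test_function:
  assumes \<rho>: "mollifier r \<rho>" and U: "cball x r \<subseteq> U"
  shows "(\<lambda>y. \<rho> (x - y)) \<in> test_functions U"
proof -
  have "{y. \<rho> (x - y) \<noteq> 0} \<subseteq> cball x r"
    using mollifier_vanishing[OF \<rho>] by (force simp: dist_norm)
  then have sub: "closure {y. \<rho> (x - y) \<noteq> 0} \<subseteq> cball x r"
    by (rule closure_minimal) simp
  then have "compact (closure {y. \<rho> (x - y) \<noteq> 0})"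
    using bounded_subset[OF bounded_cball] by (simp add: compact_eq_bounded_closed)
  then show ?thesis
    using sub U smooth_reflect(1)[of \<rho> x] \<rho> by (auto simp: test_functions_def mollifier_def)
qed

text \<open>
  At points whose closed \<open>r\<close>-ball lies in \<open>U\<close>, mollification commutes with the weak gradient: there
  \<open>y \<mapsto> \<rho> (x - y)\<close> is a test function. Here \<open>u0\<close> and \<open>g0\<close> are Borel representatives, extended by
  zero, of \<open>u\<close> and of a component of its weak gradient.
\<close>

lemma partial_mollify_weak:
  fixes u :: "real^'d \<Rightarrow> real"
  assumes wg: "has_weak_gradient U u g" and U: "open U"
    and um: "u \<in> borel_measurable (lebesgue_on U)" and gm: "g \<in> borel_measurable (lebesgue_on U)"
    and u0: "u0 \<in> borel_measurable borel" "\<forall>x. x \<notin> U \<longrightarrow> u0 x = 0"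
      "AE x in lebesgue_on U. u0 x = u x" "integrable lborel u0"
    and g0: "g0 \<in> borel_measurable borel" "\<forall>x. x \<notin> U \<longrightarrow> g0 x = 0"
      "AE x in lebesgue_on U. g0 x = g x $ i"
    and \<rho>: "mollifier r \<rho>" and x: "cball x r \<subseteq> U"
  shows "partial i (convolution u0 \<rho>) x = convolution g0 \<rho> x"
proof -
  have sm: "smooth \<rho>" using \<rho> by (simp add: mollifier_def)
  have t: "(\<lambda>y. \<rho> (x - y)) \<in> test_functions U"
    using mollifier_reflect_test_function[OF \<rho> x] .
  have Ul: "U \<in> sets lebesgue" using U by auto
  have [measurable]: "u0 \<in> borel_measurable borel" "g0 \<in> borel_measurable borel"
    "u \<in> borel_measurable (lebesgue_on U)" "g \<in> borel_measurable (lebesgue_on U)"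
    using um gm u0 g0 by auto
  have cont: "continuous_on S (\<lambda>y. k (x - y))" if "continuous_on UNIV k" for k :: "real^'d \<Rightarrow> real" and S
    by (rule continuous_on_compose2[OF that]) (auto intro!: continuous_intros)
  have tr: "(\<integral>y. f0 y * k (x - y) \<partial>lborel) = (\<integral>y. f y * k (x - y) \<partial>lebesgue_on U)"
    if [measurable]: "f0 \<in> borel_measurable borel" and z: "\<forall>x. x \<notin> U \<longrightarrow> f0 x = 0"
      and ae: "AE x in lebesgue_on U. f0 x = f x" and k: "continuous_on UNIV k"
      and [measurable]: "f \<in> borel_measurable (lebesgue_on U)"
    for f0 f k :: "real^'d \<Rightarrow> real"
  proof -
    have [measurable]: "(\<lambda>y. k (x - y)) \<in> borel_measurable borel"
      using cont[OF k] by (rule borel_measurable_continuous_onI)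
    have km [measurable]: "(\<lambda>y. k (x - y)) \<in> borel_measurable (lebesgue_on U)"
      using cont[OF k] Ul by (rule continuous_imp_measurable_on_sets_lebesgue)
    have b: "(\<lambda>y. f0 y * k (x - y)) \<in> borel_measurable borel" by measurable
    have f0m: "f0 \<in> borel_measurable (lebesgue_on U)"
      using that(1) by (simp add: measurable_completion measurable_restrict_space1)
    have "(\<integral>y. f0 y * k (x - y) \<partial>lborel) = (\<integral>y. f0 y * k (x - y) \<partial>lebesgue_on U)"
      by (rule lebesgue_on_eq_lborel(1)[OF b _ U, symmetric]) (simp add: z)
    also have "\<dots> = (\<integral>y. f y * k (x - y) \<partial>lebesgue_on U)"
    proof (rule integral_cong_AE)
      show "AE y in lebesgue_on U. f0 y * k (x - y) = f y * k (x - y)"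
        using ae by eventually_elim simp
    qed (use f0m km that in \<open>auto intro!: borel_measurable_times\<close>)
    finally show ?thesis .
  qed
  have "partial i (convolution u0 \<rho>) x = (\<integral>y. u0 y * partial i \<rho> (x - y) \<partial>lborel)"
    using partial_convolution[OF u0(4) sm mollifier_vanishing[OF \<rho>]] by (simp add: convolution_def)
  also have "\<dots> = (\<integral>y. u y * partial i \<rho> (x - y) \<partial>lebesgue_on U)"
    by (rule tr) (use u0 um smooth_continuous[OF smooth_partial[OF sm]] in auto)
  also have "\<dots> = - (\<integral>y. u y * partial i (\<lambda>y. \<rho> (x - y)) y \<partial>lebesgue_on U)"
    by (simp add: smooth_reflect(2)[OF sm])
  also have "\<dots> = (\<integral>y. g y $ i * \<rho> (x - y) \<partial>lebesgue_on U)"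
    using wg t unfolding has_weak_gradient_def by simp
  also have "\<dots> = convolution g0 \<rho> x"
    unfolding convolution_def
    by (rule tr[symmetric]) (use g0 gm smooth_continuous[OF sm] in \<open>auto intro: component_measurable\<close>)
  finally show ?thesis .
qed

lemma bounded_vanishing:
  fixes U :: "'a::real_normed_vector set"
  assumes "bounded U" "\<forall>x. x \<notin> U \<longrightarrow> f x = 0"
  obtains R where "\<forall>x. R \<le> norm x \<longrightarrow> f x = (0::real)"
proof -
  obtain B where B: "\<And>x. x \<in> U \<Longrightarrow> norm x \<le> B" using assms(1) bounded_iff by blast
  have "f x = 0" if "B + 1 \<le> norm x" for x
    using B[of x] assms(2)[THEN spec, of x] that by (cases "x \<in> U") auto
  then show ?thesis using that by blast
qed

lemma square_integrable_imp_integrable: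
  fixes f :: "'a::euclidean_space \<Rightarrow> real"
  assumes "integrable lborel (\<lambda>x. (f x)\<^sup>2)" and [measurable]: "f \<in> borel_measurable borel"
    and z: "\<forall>x. R \<le> norm x \<longrightarrow> f x = 0"
  shows "integrable lborel f"
proof (rule Bochner_Integration.integrable_bound)
  show "integrable lborel (\<lambda>x. indicator (cball (0::'a) R) x + (f x)\<^sup>2)"
    using emeasure_compact_finite[OF compact_cball, of "0::'a" R] assms(1)
    by (intro Bochner_Integration.integrable_add integrable_real_indicator) auto
  have "\<bar>f x\<bar> \<le> indicator (cball 0 R) x + (f x)\<^sup>2" for x
  proof -
    have "\<bar>f x\<bar> \<le> 1 + (f x)\<^sup>2"
      using zero_le_power2[of "\<bar>f x\<bar> - 1"] by (simp add: power2_eq_square algebra_simps)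
    then show ?thesis using z[THEN spec, of x] by (auto simp: indicator_def)
  qed
  then show "AE x in lborel. norm (f x) \<le> norm (indicator (cball 0 R) x + (f x)\<^sup>2)"
    by (intro AE_I2) (simp add: order_trans[OF _ abs_ge_self])
qed measurable

lemma bounded_on_square_integrable:
  fixes f :: "'a::euclidean_space \<Rightarrow> real"
  assumes C: "\<And>x. \<bar>f x\<bar> \<le> C" and [measurable]: "f \<in> borel_measurable borel"
    and z: "\<forall>x. R \<le> norm x \<longrightarrow> f x = 0"
  shows "integrable lborel (\<lambda>x. (f x)\<^sup>2)"
proof (rule Bochner_Integration.integrable_bound)
  show "integrable lborel (\<lambda>x. C\<^sup>2 * indicator (cball (0::'a) R) x)"
    using emeasure_compact_finite[OF compact_cball, of "0::'a" R]
    by (intro integrable_mult_right integrable_real_indicator) auto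
  have "(f x)\<^sup>2 \<le> C\<^sup>2" for x
    using power_mono[OF C[of x], of 2] by simp
  then show "AE x in lborel. norm ((f x)\<^sup>2) \<le> norm (C\<^sup>2 * indicator (cball 0 R) x)"
    using z by (intro AE_I2) (auto simp: indicator_def not_le)
qed measurable

text \<open>One sequence of mollifiers serves finitely many functions at once: in the application, a
  function and the components of its weak gradient.\<close>

lemma mollifier_sequence:
  fixes F :: "(real^'d \<Rightarrow> real) set"
  assumes "finite F" and F: "\<And>f. f \<in> F \<Longrightarrow> integrable lborel f \<and> integrable lborel (\<lambda>x. (f x)\<^sup>2) \<and>
      (\<exists>R. \<forall>x. R \<le> norm x \<longrightarrow> f x = 0)" and "\<delta> > 0"
  obtains r \<rho> where "\<And>n::nat. mollifier (r n) (\<rho> n)" "\<And>n. r n \<le> \<delta>"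
    "\<And>f n. f \<in> F \<Longrightarrow> integrable lborel (\<lambda>x. (convolution f (\<rho> n) x - f x)\<^sup>2)"
    "\<And>f. f \<in> F \<Longrightarrow> (\<lambda>n. \<integral>x. (convolution f (\<rho> n) x - f x)\<^sup>2 \<partial>lborel) \<longlonglongrightarrow> 0"
proof -
  have "\<exists>r \<rho>. mollifier r \<rho> \<and> r \<le> \<delta> \<and>
     (\<forall>f\<in>F. integrable lborel (\<lambda>x. (convolution f \<rho> x - f x)\<^sup>2) \<and>
       (\<integral>x. (convolution f \<rho> x - f x)\<^sup>2 \<partial>lborel) < 1 / real (Suc n))" for n
  proof -
    have "\<exists>d>0. \<forall>r \<rho>. r < d \<longrightarrow> mollifier r \<rho> \<longrightarrow>
        integrable lborel (\<lambda>x. (convolution f \<rho> x - f x)\<^sup>2) \<and>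
        (\<integral>x. (convolution f \<rho> x - f x)\<^sup>2 \<partial>lborel) < 1 / real (Suc n)" if fF: "f \<in> F" for f
    proof -
      obtain R where R: "\<forall>x. R \<le> norm x \<longrightarrow> f x = 0" using F[OF fF] by blast
      have p: "1 / real (Suc n) > 0" by simp
      show ?thesis
        by (rule mollify_L2[OF _ _ R p]) (use F[OF fF] in blast)+
    qed
    then have "\<forall>f\<in>F. \<exists>d. d > 0 \<and> (\<forall>r \<rho>. r < d \<longrightarrow> mollifier r \<rho> \<longrightarrow>
        integrable lborel (\<lambda>x. (convolution f \<rho> x - f x)\<^sup>2) \<and>
        (\<integral>x. (convolution f \<rho> x - f x)\<^sup>2 \<partial>lborel) < 1 / real (Suc n))"
      by blast
    from bchoice[OF this] obtain d where d: "\<forall>f\<in>F. d f > 0 \<and> (\<forall>r \<rho>. r < d f \<longrightarrow> mollifier r \<rho> \<longrightarrow>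
        integrable lborel (\<lambda>x. (convolution f \<rho> x - f x)\<^sup>2) \<and>
        (\<integral>x. (convolution f \<rho> x - f x)\<^sup>2 \<partial>lborel) < 1 / real (Suc n))" ..
    define m where "m = Min (insert \<delta> (d ` F))"
    have "m > 0" using \<open>finite F\<close> \<open>\<delta> > 0\<close> d by (auto simp: m_def)
    obtain \<rho> :: "real^'d \<Rightarrow> real" where \<rho>: "mollifier (m / 2) \<rho>"
      using mollifier_exists[of "m / 2"] \<open>m > 0\<close> by auto
    have le: "m \<le> \<delta>" "\<And>f. f \<in> F \<Longrightarrow> m \<le> d f" using \<open>finite F\<close> by (auto simp: m_def)
    have "m / 2 \<le> \<delta>" using le(1) \<open>m > 0\<close> by linarith
    moreover have "m / 2 < d f" if "f \<in> F" for f using le(2)[OF that] \<open>m > 0\<close> by linarith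
    ultimately show ?thesis using d \<rho> by (intro exI[of _ "m / 2"] exI[of _ \<rho>]) blast
  qed
  then have "\<forall>n. \<exists>q. mollifier (fst q) (snd q) \<and> fst q \<le> \<delta> \<and>
     (\<forall>f\<in>F. integrable lborel (\<lambda>x. (convolution f (snd q) x - f x)\<^sup>2) \<and>
       (\<integral>x. (convolution f (snd q) x - f x)\<^sup>2 \<partial>lborel) < 1 / real (Suc n))"
    by (simp add: split_paired_Ex)
  from choice[OF this] obtain q where q: "\<forall>n. mollifier (fst (q n)) (snd (q n)) \<and> fst (q n) \<le> \<delta> \<and>
     (\<forall>f\<in>F. integrable lborel (\<lambda>x. (convolution f (snd (q n)) x - f x)\<^sup>2) \<and>
       (\<integral>x. (convolution f (snd (q n)) x - f x)\<^sup>2 \<partial>lborel) < 1 / real (Suc n))" ..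
  define r \<rho> where "r n = fst (q n)" and "\<rho> n = snd (q n)" for n
  have *: "mollifier (r n) (\<rho> n)" "r n \<le> \<delta>"
    "f \<in> F \<Longrightarrow> integrable lborel (\<lambda>x. (convolution f (\<rho> n) x - f x)\<^sup>2)"
    "f \<in> F \<Longrightarrow> (\<integral>x. (convolution f (\<rho> n) x - f x)\<^sup>2 \<partial>lborel) < 1 / real (Suc n)" for f n
    using q by (simp_all add: r_def \<rho>_def)
  have "(\<lambda>n. \<integral>x. (convolution f (\<rho> n) x - f x)\<^sup>2 \<partial>lborel) \<longlonglongrightarrow> 0" if "f \<in> F" for f
  proof (rule tendsto_sandwich[OF _ _ tendsto_const LIMSEQ_inverse_real_of_nat])
    show "\<forall>\<^sub>F n in sequentially. 0 \<le> (\<integral>x. (convolution f (\<rho> n) x - f x)\<^sup>2 \<partial>lborel)"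
      by simp
    show "\<forall>\<^sub>F n in sequentially. (\<integral>x. (convolution f (\<rho> n) x - f x)\<^sup>2 \<partial>lborel) \<le> inverse (real (Suc n))"
      using *(4)[OF that] by (intro always_eventually allI) (simp add: inverse_eq_divide less_imp_le)
  qed
  from that[OF *(1-3) this] show ?thesis by blast
qed

text \<open>The gradients converge only locally in \<open>U\<close>, which suffices for testing with functions supported
  in \<open>K\<close>.\<close>

lemma smooth_approximation:
  fixes U :: "(real^'d) set"
  assumes U: "open U" "bounded U" and \<phi>: "\<phi> \<in> H12 U" "\<phi> \<in> Linfty U"
    and K: "compact K" "K \<subseteq> U"
  obtains p C where "\<And>n::nat. smooth (p n)" "\<And>n x. \<bar>p n x\<bar> \<le> C"
    "AE x in lebesgue_on U. (\<lambda>n. p n x) \<longlonglongrightarrow> \<phi> x"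
    "\<And>i n. integrable (lebesgue_on U) (\<lambda>x. (indicator K x * (partial i (p n) x - weak_grad U \<phi> x $ i))\<^sup>2)"
    "\<And>i. (\<lambda>n. \<integral>x. (indicator K x * (partial i (p n) x - weak_grad U \<phi> x $ i))\<^sup>2 \<partial>lebesgue_on U) \<longlonglongrightarrow> 0"
proof -
  have Ul: "U \<in> sets lebesgue" and Ub: "U \<in> sets borel" using U by auto
  let ?M = "lebesgue_on U"
  define \<Phi> where "\<Phi> = weak_grad U \<phi>"
  have \<Phi>: "\<Phi> \<in> L2 U" "has_weak_gradient U \<phi> \<Phi>"
    using weak_grad_L2[OF \<phi>(1)] by (auto simp: \<Phi>_def)
  have \<phi>m: "\<phi> \<in> borel_measurable ?M" and \<Phi>m: "\<Phi> \<in> borel_measurable ?M"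
    using \<phi> \<Phi> by (auto simp: H12_def L2_def)
  have meas: "f \<in> borel_measurable ?M" if "f \<in> borel_measurable borel" for f :: "real^'d \<Rightarrow> real"
    using that by (simp add: measurable_completion measurable_restrict_space1)
  obtain C where C: "AE x in ?M. \<bar>\<phi> x\<bar> \<le> C" using \<phi>(2) by (auto simp: Linfty_def)
  obtain h where h: "h \<in> borel_measurable borel" "\<forall>x. x \<notin> U \<longrightarrow> h x = 0" "AE x in ?M. h x = \<phi> x"
    by (rule borel_representative[OF \<phi>m U(1)])
  \<comment> \<open>On a null set \<open>h\<close> may exceed the essential bound; it is cut to zero there. For empty \<open>U\<close>
    the bound \<open>C\<close> may be negative.\<close>
  define B where "B = max C 0"
  define u where "u x = (if \<bar>h x\<bar> \<le> B then h x else 0)" for x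
  have [measurable]: "h \<in> borel_measurable borel" using h by simp
  have u [measurable]: "u \<in> borel_measurable borel" unfolding u_def by measurable
  have u0: "\<forall>x. x \<notin> U \<longrightarrow> u x = 0" using h(2) by (simp add: u_def)
  have uae: "AE x in ?M. u x = \<phi> x"
    using C h(3) by eventually_elim (auto simp: u_def B_def)
  have uB: "\<bar>u x\<bar> \<le> B" for x by (simp add: u_def B_def)
  obtain R where R: "\<forall>x. R \<le> norm x \<longrightarrow> u x = 0" using bounded_vanishing[OF U(2) u0] .
  have u2: "integrable lborel (\<lambda>x. (u x)\<^sup>2)" using bounded_on_square_integrable[OF uB u R] .
  have u1: "integrable lborel u" using square_integrable_imp_integrable[OF u2 u R] .
  have "\<exists>g. g \<in> borel_measurable borel \<and> (\<forall>x. x \<notin> U \<longrightarrow> g x = 0) \<and> (AE x in ?M. g x = \<Phi> x $ i)" for i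
  proof -
    have "(\<lambda>x. \<Phi> x $ i) \<in> borel_measurable ?M" using \<Phi>m by (rule component_measurable)
    from borel_representative[OF this U(1)] show ?thesis by blast
  qed
  then have "\<forall>i. \<exists>g. g \<in> borel_measurable borel \<and> (\<forall>x. x \<notin> U \<longrightarrow> g x = 0) \<and> (AE x in ?M. g x = \<Phi> x $ i)"
    by blast
  from choice[OF this] obtain g where "\<forall>i. g i \<in> borel_measurable borel \<and>
    (\<forall>x. x \<notin> U \<longrightarrow> g i x = 0) \<and> (AE x in ?M. g i x = \<Phi> x $ i)" ..
  then have g: "g i \<in> borel_measurable borel" "\<forall>x. x \<notin> U \<longrightarrow> g i x = 0"
    "AE x in ?M. g i x = \<Phi> x $ i" for i by simp_all
  note [measurable] = g(1)
  have g2: "integrable lborel (\<lambda>x. (g i x)\<^sup>2)" for i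
  proof -
    have a: "integrable ?M (\<lambda>x. (\<Phi> x $ i)\<^sup>2)"
    proof (rule Bochner_Integration.integrable_bound)
      show "integrable ?M (\<lambda>x. (norm (\<Phi> x))\<^sup>2)" using \<Phi> by (simp add: L2_def)
      have "\<bar>\<Phi> x $ i\<bar>\<^sup>2 \<le> (norm (\<Phi> x))\<^sup>2" for x
        by (intro power_mono component_le_norm_cart) simp
      then show "AE x in ?M. norm ((\<Phi> x $ i)\<^sup>2) \<le> norm ((norm (\<Phi> x))\<^sup>2)" by simp
    qed (use \<Phi>m in \<open>auto intro!: borel_measurable_power component_measurable\<close>)
    have ae: "AE x in ?M. (\<Phi> x $ i)\<^sup>2 = (g i x)\<^sup>2"
      using g(3)[of i] by eventually_elim simp
    have b: "(\<lambda>x. (g i x)\<^sup>2) \<in> borel_measurable borel" by measurable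
    have "integrable ?M (\<lambda>x. (g i x)\<^sup>2)"
      using integrable_cong_AE[OF borel_measurable_integrable[OF a] meas[OF b] ae] a by blast
    moreover have "\<forall>x. x \<notin> U \<longrightarrow> (g i x)\<^sup>2 = 0" using g(2)[of i] by simp
    ultimately show ?thesis
      using lebesgue_on_eq_lborel(2)[OF b _ U(1)] by blast
  qed
  have gR: "\<exists>R. \<forall>x. R \<le> norm x \<longrightarrow> g i x = 0" for i
    using bounded_vanishing[OF U(2) g(2)] by blast
  have g1: "integrable lborel (g i)" for i
    using gR square_integrable_imp_integrable[OF g2 g(1)] by blast
  obtain \<delta> where \<delta>: "\<delta> > 0" "(\<Union>x\<in>K. cball x \<delta>) \<subseteq> U"
    using compact_subset_open_imp_cball_epsilon_subset[OF K(1) U(1) K(2)] .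
  obtain r \<rho> where \<rho>: "\<And>n::nat. mollifier (r n) (\<rho> n)" "\<And>n. r n \<le> \<delta>"
    "\<And>f n. f \<in> insert u (range g) \<Longrightarrow> integrable lborel (\<lambda>x. (convolution f (\<rho> n) x - f x)\<^sup>2)"
    "\<And>f. f \<in> insert u (range g) \<Longrightarrow> (\<lambda>n. \<integral>x. (convolution f (\<rho> n) x - f x)\<^sup>2 \<partial>lborel) \<longlonglongrightarrow> 0"
  proof (rule mollifier_sequence[of "insert u (range g)" \<delta>])
    show "integrable lborel f \<and> integrable lborel (\<lambda>x. (f x)\<^sup>2) \<and> (\<exists>R. \<forall>x. R \<le> norm x \<longrightarrow> f x = 0)"
      if "f \<in> insert u (range g)" for f
      using that u1 u2 R g1 g2 gR by auto
  qed (use \<delta> in auto)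
  \<comment> \<open>Convergence in \<open>L\<^sup>2\<close> gives convergence almost everywhere along a subsequence.\<close>
  obtain s :: "nat \<Rightarrow> nat" where s: "strict_mono s"
    and lim0: "AE x in lborel. (\<lambda>n. (convolution u (\<rho> (s n)) x - u x)\<^sup>2) \<longlonglongrightarrow> 0"
    using tendsto_L1_AE_subseq[of lborel "\<lambda>n x. (convolution u (\<rho> n) x - u x)\<^sup>2"] \<rho>(3,4)[of u]
    by auto
  have "AE x in lebesgue. x \<in> U \<longrightarrow> (\<lambda>n. (convolution u (\<rho> (s n)) x - u x)\<^sup>2) \<longlonglongrightarrow> 0"
    using AE_completion[OF lim0] by eventually_elim blast
  then have lim: "AE x in ?M. (\<lambda>n. (convolution u (\<rho> (s n)) x - u x)\<^sup>2) \<longlonglongrightarrow> 0"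
    using AE_restrict_space_iff[of U lebesgue] Ul by simp
  define p where "p n = convolution u (\<rho> (s n))" for n
  have grad_p: "partial i (p n) x = convolution (g i) (\<rho> (s n)) x" if "x \<in> K" for i n x
    unfolding p_def
  proof (rule partial_mollify_weak[OF \<Phi>(2) U(1) \<phi>m \<Phi>m u u0 uae u1 g \<rho>(1)])
    have "cball x (r (s n)) \<subseteq> cball x \<delta>" using \<rho>(2) by (intro subset_cball) simp
    then show "cball x (r (s n)) \<subseteq> U" using \<delta>(2) that by blast
  qed
  define D where "D i n x = (convolution (g i) (\<rho> (s n)) x - g i x)\<^sup>2" for i n x
  define E where "E i n x = (indicator K x * (partial i (p n) x - \<Phi> x $ i))\<^sup>2" for i n x
  have Kl: "K \<in> sets lebesgue" "K \<in> sets borel" using K(1) by (auto simp: borel_compact)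
  have EK: "AE x in ?M. E i n x = indicator K x * D i n x" for i n
    using g(3)[of i] by eventually_elim (auto simp: E_def D_def grad_p indicator_def)
  have [measurable]: "convolution (g i) (\<rho> n) \<in> borel_measurable borel" for i n
    using convolution_measurable[OF g1 \<rho>(1)] .
  have [measurable]: "K \<in> sets borel" "U \<in> sets borel" using Kl Ub by auto
  have DI: "integrable lborel (D i n)" for i n
    using \<rho>(3)[of "g i" "s n"] by (simp add: D_def[abs_def])
  have KDb: "(\<lambda>x. indicator K x * D i n x) \<in> borel_measurable borel" for i n
    unfolding D_def by measurable
  have KDI: "integrable lborel (\<lambda>x. indicator K x * D i n x)" for i n
    using integrable_mult_indicator[OF _ DI, of K] by simp
  have KD: "integral\<^sup>L ?M (\<lambda>x. indicator K x * D i n x) = integral\<^sup>L lborel (\<lambda>x. indicator K x * D i n x)"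
    "integrable ?M (\<lambda>x. indicator K x * D i n x)" for i n
    using lebesgue_on_eq_lborel[OF KDb _ U(1), of i n] K(2) KDI by (auto simp: indicator_def)
  have sm: "smooth (p n)" for n unfolding p_def by (rule smooth_mollify[OF u1 \<rho>(1)])
  have Em: "E i n \<in> borel_measurable ?M" for i n
  proof -
    have "partial i (p n) \<in> borel_measurable borel"
      by (intro borel_measurable_continuous_onI smooth_continuous smooth_partial sm)
    then have "partial i (p n) \<in> borel_measurable ?M" by (rule meas)
    moreover have "(\<lambda>x. indicator K x :: real) \<in> borel_measurable ?M" by (rule meas) measurable
    moreover have "(\<lambda>x. \<Phi> x $ i) \<in> borel_measurable ?M" using \<Phi>m by (rule component_measurable)
    ultimately show ?thesis unfolding E_def[abs_def] by measurable
  qed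
  have EI: "integrable ?M (E i n)" for i n
    using integrable_cong_AE[OF Em meas[OF KDb] EK] KD(2) by blast
  have El: "(\<lambda>n. integral\<^sup>L ?M (E i n)) \<longlonglongrightarrow> 0" for i
  proof (rule tendsto_sandwich[OF _ _ tendsto_const])
    show "(\<lambda>n. integral\<^sup>L lborel (D i n)) \<longlonglongrightarrow> 0"
      using LIMSEQ_subseq_LIMSEQ[OF \<rho>(4)[of "g i"] s] by (simp add: D_def[abs_def] o_def)
    show "\<forall>\<^sub>F n in sequentially. 0 \<le> integral\<^sup>L ?M (E i n)"
      by (simp add: E_def[abs_def])
    show "\<forall>\<^sub>F n in sequentially. integral\<^sup>L ?M (E i n) \<le> integral\<^sup>L lborel (D i n)"
    proof (intro always_eventually allI)
      fix n
      have "integral\<^sup>L ?M (E i n) = integral\<^sup>L lborel (\<lambda>x. indicator K x * D i n x)"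
        using integral_cong_AE[OF Em meas[OF KDb] EK] KD(1) by simp
      also have "\<dots> \<le> integral\<^sup>L lborel (D i n)"
        using KDI DI by (intro integral_mono) (auto simp: indicator_def D_def)
      finally show "integral\<^sup>L ?M (E i n) \<le> integral\<^sup>L lborel (D i n)" .
    qed
  qed
  show ?thesis
  proof (rule that[of p B])
    show "\<bar>p n x\<bar> \<le> B" for n x
      unfolding p_def by (rule convolution_bounded[OF u1 uB \<rho>(1)])
    show "AE x in ?M. (\<lambda>n. p n x) \<longlonglongrightarrow> \<phi> x"
      using lim uae
    proof eventually_elim
      case (elim x)
      from tendsto_real_sqrt[OF elim(1)] have "(\<lambda>n. \<bar>p n x - u x\<bar>) \<longlonglongrightarrow> 0" by (simp add: p_def)
      then show ?case using elim(2) by (simp add: LIM_zero_iff tendsto_rabs_zero_iff)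
    qed
  qed (use sm EI El in \<open>auto simp: E_def[abs_def] \<Phi>_def\<close>)
qed

section \<open>Products of square integrable functions\<close>

lemma abs_mult_le_squares: "\<bar>a * b\<bar> \<le> a\<^sup>2 + (b::real)\<^sup>2"
proof -
  have "2 * \<bar>a * b\<bar> \<le> a\<^sup>2 + b\<^sup>2"
    using zero_le_power2[of "\<bar>a\<bar> - \<bar>b\<bar>"] by (simp add: power2_diff abs_mult)
  moreover have "0 \<le> \<bar>a * b\<bar>" by simp
  ultimately show ?thesis by linarith
qed

lemma integrable_mult_L2:
  fixes X Y :: "'a \<Rightarrow> real"
  assumes [measurable]: "X \<in> borel_measurable M" "Y \<in> borel_measurable M"
    and "integrable M (\<lambda>x. (X x)\<^sup>2)" "integrable M (\<lambda>x. (Y x)\<^sup>2)"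
  shows "integrable M (\<lambda>x. X x * Y x)"
proof (rule Bochner_Integration.integrable_bound)
  show "integrable M (\<lambda>x. (X x)\<^sup>2 + (Y x)\<^sup>2)" using assms by simp
  show "AE x in M. norm (X x * Y x) \<le> norm ((X x)\<^sup>2 + (Y x)\<^sup>2)"
    by (intro AE_I2) (simp add: abs_mult_le_squares)
qed measurable

lemma integral_Cauchy_Schwarz:
  fixes X Y :: "'a \<Rightarrow> real"
  assumes [measurable]: "X \<in> borel_measurable M" "Y \<in> borel_measurable M"
    and X: "integrable M (\<lambda>x. (X x)\<^sup>2)" and Y: "integrable M (\<lambda>x. (Y x)\<^sup>2)"
  shows "\<bar>\<integral>x. X x * Y x \<partial>M\<bar> \<le> sqrt (\<integral>x. (X x)\<^sup>2 \<partial>M) * sqrt (\<integral>x. (Y x)\<^sup>2 \<partial>M)"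
proof -
  define a b c where "a = (\<integral>x. (X x)\<^sup>2 \<partial>M)" "b = (\<integral>x. X x * Y x \<partial>M)" "c = (\<integral>x. (Y x)\<^sup>2 \<partial>M)"
  note XY = integrable_mult_L2[OF assms]
  have q: "0 \<le> a - 2 * t * b + t\<^sup>2 * c" for t
  proof -
    have "0 \<le> (\<integral>x. (X x - t * Y x)\<^sup>2 \<partial>M)"
      by simp
    also have "\<dots> = (\<integral>x. (X x)\<^sup>2 - 2 * t * (X x * Y x) + t\<^sup>2 * (Y x)\<^sup>2 \<partial>M)"
      by (intro Bochner_Integration.integral_cong) (auto simp: power2_eq_square algebra_simps)
    also have "\<dots> = a - 2 * t * b + t\<^sup>2 * c"
      using X Y XY by (simp add: a_b_c_def)
    finally show ?thesis .
  qed
  have c: "c \<ge> 0" by (simp add: a_b_c_def)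
  have "b\<^sup>2 \<le> a * c"
  proof (cases "c = 0")
    case True
    have "b = 0"
    proof (rule ccontr)
      assume "b \<noteq> 0"
      then show False using q[of "(a + 1) / (2 * b)"] True by simp
    qed
    then show ?thesis using True by simp
  next
    case False
    then have "c > 0" using c by simp
    then show ?thesis
      using q[of "b / c"] by (simp add: power2_eq_square field_simps)
  qed
  then have "sqrt (b\<^sup>2) \<le> sqrt (a * c)" by (rule real_sqrt_le_mono)
  then show ?thesis by (simp add: real_sqrt_mult a_b_c_def)
qed

text \<open>
  The coefficients \<open>e n\<close> converge boundedly almost everywhere and the factors \<open>Y n\<close> converge in
  \<open>L\<^sup>2\<close>. In \<open>e n X Y n = e n X (Y n - Z) + e n X Z\<close> the first term tends to zero by Cauchy-Schwarz and
  the second converges by dominated convergence.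
\<close>

lemma tendsto_integral_bounded_L2:
  fixes X Z :: "'a \<Rightarrow> real" and Y e :: "nat \<Rightarrow> 'a \<Rightarrow> real"
  assumes X: "X \<in> borel_measurable M" "integrable M (\<lambda>x. (X x)\<^sup>2)"
    and Z: "Z \<in> borel_measurable M" "integrable M (\<lambda>x. (Z x)\<^sup>2)"
    and Y: "\<And>n. Y n \<in> borel_measurable M" "\<And>n. integrable M (\<lambda>x. (Y n x - Z x)\<^sup>2)"
      "(\<lambda>n. \<integral>x. (Y n x - Z x)\<^sup>2 \<partial>M) \<longlonglongrightarrow> 0"
    and e: "\<And>n. e n \<in> borel_measurable M" "\<And>n x. \<bar>e n x\<bar> \<le> B"
      "AE x in M. (\<lambda>n. e n x) \<longlonglongrightarrow> e' x" and e': "e' \<in> borel_measurable M"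
  shows "integrable M (\<lambda>x. e n x * (X x * Y n x))"
    and "(\<lambda>n. \<integral>x. e n x * (X x * Y n x) \<partial>M) \<longlonglongrightarrow> (\<integral>x. e' x * (X x * Z x) \<partial>M)"
proof -
  note [measurable] = X(1) Z(1) Y(1) e(1) e'
  have XZ: "integrable M (\<lambda>x. X x * Z x)" by (intro integrable_mult_L2 X Z)
  have eX: "integrable M (\<lambda>x. (e n x * X x)\<^sup>2)"
    and eXle: "(\<integral>x. (e n x * X x)\<^sup>2 \<partial>M) \<le> (\<integral>x. B\<^sup>2 * (X x)\<^sup>2 \<partial>M)" for n
  proof -
    have le: "(e n x * X x)\<^sup>2 \<le> B\<^sup>2 * (X x)\<^sup>2" for x
      using power_mono[OF e(2)[of n x], of 2]
      unfolding power_mult_distrib by (intro mult_right_mono) auto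
    have i: "integrable M (\<lambda>x. B\<^sup>2 * (X x)\<^sup>2)" using X by simp
    show j: "integrable M (\<lambda>x. (e n x * X x)\<^sup>2)"
    proof (rule Bochner_Integration.integrable_bound[OF i])
      show "AE x in M. norm ((e n x * X x)\<^sup>2) \<le> norm (B\<^sup>2 * (X x)\<^sup>2)"
        using le by (intro AE_I2) simp
    qed measurable
    show "(\<integral>x. (e n x * X x)\<^sup>2 \<partial>M) \<le> (\<integral>x. B\<^sup>2 * (X x)\<^sup>2 \<partial>M)"
      by (intro integral_mono i j le)
  qed
  have d: "integrable M (\<lambda>x. (e n x * X x) * (Y n x - Z x))" for n
    by (rule integrable_mult_L2) (use eX Y in auto)
  have eXZ: "integrable M (\<lambda>x. e n x * (X x * Z x))" for n
  proof (rule Bochner_Integration.integrable_bound)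
    show "integrable M (\<lambda>x. B * \<bar>X x * Z x\<bar>)" using XZ by auto
    have "\<bar>e n x * (X x * Z x)\<bar> \<le> B * \<bar>X x * Z x\<bar>" for x
      unfolding abs_mult[of "e n x"] by (intro mult_right_mono e) simp
    then show "AE x in M. norm (e n x * (X x * Z x)) \<le> norm (B * \<bar>X x * Z x\<bar>)"
      by (intro AE_I2) (simp only: real_norm_def order_trans[OF _ abs_ge_self])
  qed measurable
  have sum: "e n x * (X x * Y n x) = (e n x * X x) * (Y n x - Z x) + e n x * (X x * Z x)" for n x
    by (simp add: algebra_simps)
  show "integrable M (\<lambda>x. e n x * (X x * Y n x))"
    unfolding sum by (intro Bochner_Integration.integrable_add d eXZ)
  have "(\<lambda>n. \<integral>x. (e n x * X x) * (Y n x - Z x) \<partial>M) \<longlonglongrightarrow> 0"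
  proof (rule Lim_null_comparison)
    have "\<bar>\<integral>x. (e n x * X x) * (Y n x - Z x) \<partial>M\<bar>
        \<le> sqrt (\<integral>x. B\<^sup>2 * (X x)\<^sup>2 \<partial>M) * sqrt (\<integral>x. (Y n x - Z x)\<^sup>2 \<partial>M)" for n
    proof -
      have "\<bar>\<integral>x. (e n x * X x) * (Y n x - Z x) \<partial>M\<bar>
          \<le> sqrt (\<integral>x. (e n x * X x)\<^sup>2 \<partial>M) * sqrt (\<integral>x. (Y n x - Z x)\<^sup>2 \<partial>M)"
        by (rule integral_Cauchy_Schwarz) (use eX Y in auto)
      also have "\<dots> \<le> sqrt (\<integral>x. B\<^sup>2 * (X x)\<^sup>2 \<partial>M) * sqrt (\<integral>x. (Y n x - Z x)\<^sup>2 \<partial>M)"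
        by (intro mult_right_mono real_sqrt_le_mono eXle) simp
      finally show ?thesis .
    qed
    then show "\<forall>\<^sub>F n in sequentially. norm (\<integral>x. (e n x * X x) * (Y n x - Z x) \<partial>M)
        \<le> sqrt (\<integral>x. B\<^sup>2 * (X x)\<^sup>2 \<partial>M) * sqrt (\<integral>x. (Y n x - Z x)\<^sup>2 \<partial>M)"
      by (intro always_eventually allI) simp
    show "(\<lambda>n. sqrt (\<integral>x. B\<^sup>2 * (X x)\<^sup>2 \<partial>M) * sqrt (\<integral>x. (Y n x - Z x)\<^sup>2 \<partial>M)) \<longlonglongrightarrow> 0"
      using tendsto_mult[OF tendsto_const tendsto_real_sqrt[OF Y(3)]] by simp
  qed
  moreover have "(\<lambda>n. \<integral>x. e n x * (X x * Z x) \<partial>M) \<longlonglongrightarrow> (\<integral>x. e' x * (X x * Z x) \<partial>M)"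
  proof (rule integral_dominated_convergence)
    show "integrable M (\<lambda>x. B * \<bar>X x * Z x\<bar>)" using XZ by auto
    have "\<bar>e n x * (X x * Z x)\<bar> \<le> B * \<bar>X x * Z x\<bar>" for n x
      unfolding abs_mult[of "e n x"] by (intro mult_right_mono e) simp
    then show "AE x in M. norm (e n x * (X x * Z x)) \<le> B * \<bar>X x * Z x\<bar>" for n by simp
    show "AE x in M. (\<lambda>n. e n x * (X x * Z x)) \<longlonglongrightarrow> e' x * (X x * Z x)"
      using e(3) by eventually_elim (intro tendsto_intros)
  qed measurable
  ultimately have "(\<lambda>n. (\<integral>x. (e n x * X x) * (Y n x - Z x) \<partial>M) + (\<integral>x. e n x * (X x * Z x) \<partial>M))
      \<longlonglongrightarrow> 0 + (\<integral>x. e' x * (X x * Z x) \<partial>M)"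
    by (rule tendsto_add)
  then show "(\<lambda>n. \<integral>x. e n x * (X x * Y n x) \<partial>M) \<longlonglongrightarrow> (\<integral>x. e' x * (X x * Z x) \<partial>M)"
    unfolding sum using d eXZ by simp
qed

lemma L2_measurable: "A \<in> L2 U \<Longrightarrow> A \<in> borel_measurable (lebesgue_on U)"
  by (simp add: L2_def)

lemma L2_integrable_inner:
  assumes "A \<in> L2 U" "B \<in> L2 U"
  shows "integrable (lebesgue_on U) (\<lambda>x. A x \<bullet> B x)"
proof (rule Bochner_Integration.integrable_bound)
  note [measurable] = L2_measurable[OF assms(1)] L2_measurable[OF assms(2)]
  show "integrable (lebesgue_on U) (\<lambda>x. (norm (A x))\<^sup>2 + (norm (B x))\<^sup>2)"
    using assms by (simp add: L2_def)
  have "\<bar>A x \<bullet> B x\<bar> \<le> (norm (A x))\<^sup>2 + (norm (B x))\<^sup>2" for x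
    using Cauchy_Schwarz_ineq2[of "A x" "B x"] abs_mult_le_squares[of "norm (A x)" "norm (B x)"]
    by simp
  then show "AE x in lebesgue_on U. norm (A x \<bullet> B x) \<le> norm ((norm (A x))\<^sup>2 + (norm (B x))\<^sup>2)"
    by (intro AE_I2) simp
  show "(\<lambda>x. A x \<bullet> B x) \<in> borel_measurable (lebesgue_on U)" by measurable
qed

lemma L2_scaleR:
  assumes A: "A \<in> L2 U" and h: "h \<in> borel_measurable (lebesgue_on U)"
    and B: "AE x in lebesgue_on U. \<bar>h x\<bar> \<le> B"
  shows "(\<lambda>x. h x *\<^sub>R A x) \<in> L2 U"
proof -
  note [measurable] = L2_measurable[OF A] h
  have "integrable (lebesgue_on U) (\<lambda>x. (norm (h x *\<^sub>R A x))\<^sup>2)"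
  proof (rule Bochner_Integration.integrable_bound)
    show "integrable (lebesgue_on U) (\<lambda>x. B\<^sup>2 * (norm (A x))\<^sup>2)"
      using A by (simp add: L2_def)
    show "AE x in lebesgue_on U. norm ((norm (h x *\<^sub>R A x))\<^sup>2) \<le> norm (B\<^sup>2 * (norm (A x))\<^sup>2)"
      using B
    proof eventually_elim
      case (elim x)
      have "\<bar>h x\<bar>\<^sup>2 \<le> B\<^sup>2" by (intro power_mono elim) simp
      then have "\<bar>h x\<bar>\<^sup>2 * (norm (A x))\<^sup>2 \<le> B\<^sup>2 * (norm (A x))\<^sup>2" by (rule mult_right_mono) simp
      then show ?case by (simp add: power_mult_distrib)
    qed
  qed measurable
  then show ?thesis by (simp add: L2_def)
qed

lemma L2_add:
  assumes "A \<in> L2 U" "B \<in> L2 U" shows "(\<lambda>x. A x + B x) \<in> L2 U"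
proof -
  note [measurable] = L2_measurable[OF assms(1)] L2_measurable[OF assms(2)]
  have "integrable (lebesgue_on U) (\<lambda>x. (norm (A x + B x))\<^sup>2)"
  proof (rule Bochner_Integration.integrable_bound)
    show "integrable (lebesgue_on U) (\<lambda>x. 2 * (norm (A x))\<^sup>2 + 2 * (norm (B x))\<^sup>2)"
      using assms by (simp add: L2_def)
    have "(norm (A x + B x))\<^sup>2 \<le> 2 * (norm (A x))\<^sup>2 + 2 * (norm (B x))\<^sup>2" for x
      by (rule order_trans[OF power_mono[OF norm_triangle_ineq norm_ge_zero] power2_add_le])
    then show "AE x in lebesgue_on U. norm ((norm (A x + B x))\<^sup>2)
        \<le> norm (2 * (norm (A x))\<^sup>2 + 2 * (norm (B x))\<^sup>2)"
      by (intro AE_I2) simp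
  qed measurable
  then show ?thesis by (simp add: L2_def)
qed

lemma integrable_bounded_mult:
  fixes f h :: "'a \<Rightarrow> real"
  assumes f: "integrable M f" and [measurable]: "h \<in> borel_measurable M"
    and B: "AE x in M. \<bar>h x\<bar> \<le> B"
  shows "integrable M (\<lambda>x. h x * f x)"
proof (rule Bochner_Integration.integrable_bound)
  show "integrable M (\<lambda>x. B * \<bar>f x\<bar>)" using f by auto
  show "AE x in M. norm (h x * f x) \<le> norm (B * \<bar>f x\<bar>)"
    using B
  proof eventually_elim
    case (elim x)
    then have "\<bar>h x\<bar> * \<bar>f x\<bar> \<le> \<bar>B\<bar> * \<bar>f x\<bar>" by (intro mult_right_mono) auto
    then show ?case by (simp add: abs_mult)
  qed
  show "(\<lambda>x. h x * f x) \<in> borel_measurable M" using f by measurable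
qed

section \<open>Test functions and weak functionals\<close>

lemma test_functions_bounded:
  assumes \<psi>: "\<psi> \<in> test_functions U"
  obtains B where "\<And>x. \<bar>\<psi> x\<bar> \<le> B" "\<And>x. norm (grad \<psi> x) \<le> B"
proof -
  have "bounded (closure {x. \<psi> x \<noteq> 0})"
    using \<psi> by (auto simp: test_functions_def compact_imp_bounded)
  then obtain R where R: "\<forall>x. R \<le> norm x \<longrightarrow> \<psi> x = 0"
    using bounded_vanishing[of "closure {x. \<psi> x \<noteq> 0}" \<psi>] test_functions_vanishing(1)[OF \<psi>] by blast
  have sm: "smooth \<psi>" using test_functions_smooth[OF \<psi>] .
  have R': "\<forall>x. R + 1 \<le> norm x \<longrightarrow> grad \<psi> x = 0"
    using smooth_partial_vanishing[OF R] by (simp add: grad_def vec_eq_iff)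
  obtain B1 where B1: "\<And>x. norm (\<psi> x) \<le> B1"
    using continuous_vanishing_bounded[OF smooth_continuous[OF sm] R] by blast
  obtain B2 where B2: "\<And>x. norm (grad \<psi> x) \<le> B2"
    using continuous_vanishing_bounded[OF smooth_grad_continuous[OF sm] R'] by blast
  show ?thesis
  proof (rule that[of "max B1 B2"])
    show "\<bar>\<psi> x\<bar> \<le> max B1 B2" for x using B1[of x] by simp
    show "norm (grad \<psi> x) \<le> max B1 B2" for x using B2[of x] by simp
  qed
qed

lemma smooth_measurable:
  assumes "smooth f" "open U"
  shows "f \<in> borel_measurable (lebesgue_on U)" "grad f \<in> borel_measurable (lebesgue_on U)"
  using assms by (auto intro!: continuous_imp_measurable_on_sets_lebesgue
      smooth_continuous smooth_grad_continuous)

lemma grad_test_function_L2: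
  assumes \<psi>: "\<psi> \<in> test_functions U" and U: "open U" "bounded U"
  shows "grad \<psi> \<in> L2 U"
proof -
  obtain B where B: "\<And>x. norm (grad \<psi> x) \<le> B" using test_functions_bounded[OF \<psi>] by blast
  interpret finite_measure "lebesgue_on U"
    using U by (intro finite_measure_lebesgue_on lmeasurable_open) auto
  note [measurable] = smooth_measurable(2)[OF test_functions_smooth[OF \<psi>] U(1)]
  have "integrable (lebesgue_on U) (\<lambda>x. (norm (grad \<psi> x))\<^sup>2)"
  proof (rule integrable_const_bound)
    show "AE x in lebesgue_on U. norm ((norm (grad \<psi> x))\<^sup>2) \<le> B\<^sup>2"
      using power_mono[OF B] by (intro AE_I2) simp
  qed measurable
  then show ?thesis by (simp add: L2_def)
qed

lemma integrable_test_functional: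
  assumes A: "A \<in> L2 U" and B: "integrable (lebesgue_on U) B"
    and \<psi>: "\<psi> \<in> test_functions U" and U: "open U" "bounded U"
  shows "integrable (lebesgue_on U) (\<lambda>x. A x \<bullet> grad \<psi> x + B x * \<psi> x)"
proof -
  obtain C where C: "\<And>x. \<bar>\<psi> x\<bar> \<le> C" using test_functions_bounded[OF \<psi>] by blast
  have "integrable (lebesgue_on U) (\<lambda>x. \<psi> x * B x)"
    using C by (intro integrable_bounded_mult[OF B, where B=C]
        smooth_measurable(1)[OF test_functions_smooth[OF \<psi>] U(1)]) auto
  then show ?thesis
    using L2_integrable_inner[OF A grad_test_function_L2[OF \<psi> U]] by (simp add: mult.commute)
qed

lemma grad_exp_mult:
  assumes "smooth p" "smooth \<psi>"
  shows "grad (\<lambda>x. exp (a * p x) * \<psi> x) x = exp (a * p x) *\<^sub>R (grad \<psi> x + (a * \<psi> x) *\<^sub>R grad p x)"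
proof -
  have d: "((\<lambda>x. exp (a * p x) * \<psi> x) has_derivative
      (\<lambda>h. exp (a * p x) * (grad \<psi> x \<bullet> h) + (exp (a * p x) * (a * (grad p x \<bullet> h))) * \<psi> x)) (at x)"
    by (auto intro!: derivative_eq_intros smooth_has_derivative assms)
  show ?thesis
    by (simp add: vec_eq_iff grad_def partial_eq[OF d] inner_axis)
      (simp add: algebra_simps)
qed

section \<open>Exponential weights in weak equations\<close>

text \<open>The weak equation may be tested with \<open>exp (a \<phi>) \<psi>\<close>, with the gradient expanded by the product
  and chain rules.\<close>

lemma weak_equation_exp_weight:
  fixes U :: "(real^'d) set" and A :: "real^'d \<Rightarrow> real^'d"
  assumes U: "open U" "bounded U" and \<phi>: "\<phi> \<in> H12 U" "\<phi> \<in> Linfty U"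
    and A: "A \<in> L2 U" and B: "integrable (lebesgue_on U) B"
    and eq: "\<And>\<psi>. \<psi> \<in> test_functions U \<Longrightarrow> (\<integral>x. A x \<bullet> grad \<psi> x + B x * \<psi> x \<partial>lebesgue_on U) = 0"
    and \<psi>: "\<psi> \<in> test_functions U"
  shows "(\<integral>x. exp (a * \<phi> x) * (A x \<bullet> grad \<psi> x + a * (A x \<bullet> weak_grad U \<phi> x) * \<psi> x + B x * \<psi> x)
            \<partial>lebesgue_on U) = 0"
proof -
  let ?M = "lebesgue_on U"
  define K where "K = closure {x. \<psi> x \<noteq> 0}"
  have K: "compact K" "K \<subseteq> U" using \<psi> by (auto simp: test_functions_def K_def)
  define \<Phi> where "\<Phi> = weak_grad U \<phi>"
  have \<Phi>: "\<Phi> \<in> L2 U" using weak_grad_L2(1)[OF \<phi>(1)] by (simp add: \<Phi>_def)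
  obtain p C where p: "\<And>n::nat. smooth (p n)" and pC: "\<And>n x. \<bar>p n x\<bar> \<le> C"
    and plim: "AE x in ?M. (\<lambda>n. p n x) \<longlonglongrightarrow> \<phi> x"
    and gI: "\<And>i n. integrable ?M (\<lambda>x. (indicator K x * (partial i (p n) x - \<Phi> x $ i))\<^sup>2)"
    and glim: "\<And>i. (\<lambda>n. \<integral>x. (indicator K x * (partial i (p n) x - \<Phi> x $ i))\<^sup>2 \<partial>?M) \<longlonglongrightarrow> 0"
    by (rule smooth_approximation[OF U \<phi> K]) (auto simp: \<Phi>_def)
  have sm: "smooth \<psi>" using test_functions_smooth[OF \<psi>] .
  obtain P where P: "\<And>x. \<bar>\<psi> x\<bar> \<le> P" using test_functions_bounded[OF \<psi>] by blast
  define E where "E n x = exp (a * p n x)" for n x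
  define e where "e x = exp (a * \<phi> x)" for x
  define L where "L = exp (\<bar>a\<bar> * C)"
  have EL: "\<bar>E n x\<bar> \<le> L" for n x
  proof -
    have "a * p n x \<le> \<bar>a\<bar> * \<bar>p n x\<bar>" by (simp add: abs_mult[symmetric])
    also have "\<dots> \<le> \<bar>a\<bar> * C" using pC by (intro mult_left_mono) auto
    finally show ?thesis by (simp add: E_def L_def)
  qed
  have Elim: "AE x in ?M. (\<lambda>n. E n x) \<longlonglongrightarrow> e x"
    using plim by eventually_elim (auto simp: E_def e_def intro!: tendsto_intros)
  have smE: "smooth (E n)" for n unfolding E_def by (intro smooth_exp p)
  have Em: "E n \<in> borel_measurable ?M" for n using smooth_measurable(1)[OF smE U(1)] .
  have \<phi>m: "\<phi> \<in> borel_measurable ?M" using \<phi> by (simp add: H12_def L2_def)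
  then have em: "e \<in> borel_measurable ?M" unfolding e_def by measurable
  note [measurable] = Em em \<phi>m L2_measurable[OF A] L2_measurable[OF \<Phi>]
    smooth_measurable[OF sm U(1)]

  define F where "F x = A x \<bullet> grad \<psi> x + B x * \<psi> x" for x
  have F: "integrable ?M F"
    unfolding F_def by (rule integrable_test_functional[OF A B \<psi> U])
  have EF: "integrable ?M (\<lambda>x. E n x * F x)" for n
    by (rule integrable_bounded_mult[OF F Em]) (use EL in auto)
  have eF: "integrable ?M (\<lambda>x. e x * F x)"
    and limF: "(\<lambda>n. \<integral>x. E n x * F x \<partial>?M) \<longlonglongrightarrow> (\<integral>x. e x * F x \<partial>?M)"
  proof -
    have w: "integrable ?M (\<lambda>x. L * \<bar>F x\<bar>)" using F by auto
    have [measurable]: "F \<in> borel_measurable ?M" using F by simp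
    have lim: "AE x in ?M. (\<lambda>n. E n x * F x) \<longlonglongrightarrow> e x * F x"
      using Elim by eventually_elim (intro tendsto_intros)
    have "\<bar>E n x * F x\<bar> \<le> L * \<bar>F x\<bar>" for n x
      unfolding abs_mult by (intro mult_right_mono EL) simp
    then have bd: "AE x in ?M. norm (E n x * F x) \<le> L * \<bar>F x\<bar>" for n by simp
    show "integrable ?M (\<lambda>x. e x * F x)"
      by (rule integrable_dominated_convergence[OF _ _ w lim bd]) measurable
    show "(\<lambda>n. \<integral>x. E n x * F x \<partial>?M) \<longlonglongrightarrow> (\<integral>x. e x * F x \<partial>?M)"
      by (rule integral_dominated_convergence[OF _ _ w lim bd]) measurable
  qed

  define X where "X i x = \<psi> x * A x $ i" for i x
  define Y where "Y i n x = indicator K x * partial i (p n) x" for i n x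
  define Z where "Z i x = indicator K x * \<Phi> x $ i" for i x
  have Kl: "(\<lambda>x. indicator K x :: real) \<in> borel_measurable ?M"
  proof -
    have "K \<in> sets borel" using K(1) by (simp add: borel_compact)
    then have "(\<lambda>x. indicator K x :: real) \<in> borel_measurable borel" by measurable
    then show ?thesis by (simp add: measurable_completion measurable_restrict_space1)
  qed
  have sq: "integrable ?M (\<lambda>x. (V x $ i)\<^sup>2)" if "V \<in> L2 U" for V :: "real^'d \<Rightarrow> real^'d" and i
  proof (rule Bochner_Integration.integrable_bound)
    show "integrable ?M (\<lambda>x. (norm (V x))\<^sup>2)" using that by (simp add: L2_def)
    have "\<bar>V x $ i\<bar>\<^sup>2 \<le> (norm (V x))\<^sup>2" for x
      by (intro power_mono component_le_norm_cart) simp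
    then show "AE x in ?M. norm ((V x $ i)\<^sup>2) \<le> norm ((norm (V x))\<^sup>2)" by simp
  qed (intro borel_measurable_power component_measurable L2_measurable that)
  have Xm: "X i \<in> borel_measurable ?M" for i
    unfolding X_def[abs_def]
    by (intro borel_measurable_times component_measurable L2_measurable A smooth_measurable(1)[OF sm U(1)])
  have X2: "integrable ?M (\<lambda>x. (X i x)\<^sup>2)" for i
    unfolding X_def power_mult_distrib
  proof (rule integrable_bounded_mult[OF sq[OF A]])
    have "(\<psi> x)\<^sup>2 \<le> P\<^sup>2" for x using power_mono[OF P[of x], of 2] by simp
    then show "AE x in ?M. \<bar>(\<psi> x)\<^sup>2\<bar> \<le> P\<^sup>2" by simp
  qed measurable
  have Zm: "Z i \<in> borel_measurable ?M" for i
    unfolding Z_def[abs_def]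
    by (intro borel_measurable_times component_measurable L2_measurable \<Phi> Kl)
  have Z2: "integrable ?M (\<lambda>x. (Z i x)\<^sup>2)" for i
    unfolding Z_def power_mult_distrib
  proof (rule integrable_bounded_mult[OF sq[OF \<Phi>]])
    show "AE x in ?M. \<bar>(indicator K x)\<^sup>2\<bar> \<le> (1::real)" by (intro AE_I2) (simp add: indicator_def)
    show "(\<lambda>x. (indicator K x :: real)\<^sup>2) \<in> borel_measurable ?M" using Kl by measurable
  qed
  have Ym: "Y i n \<in> borel_measurable ?M" for i n
    unfolding Y_def[abs_def]
    by (intro borel_measurable_times Kl smooth_measurable(1)[OF smooth_partial[OF p] U(1)])
  have YZ: "Y i n x - Z i x = indicator K x * (partial i (p n) x - \<Phi> x $ i)" for i n x
    by (simp add: Y_def Z_def algebra_simps)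
  have YI: "integrable ?M (\<lambda>x. (Y i n x - Z i x)\<^sup>2)" for i n unfolding YZ by (rule gI)
  have Ylim: "(\<lambda>n. \<integral>x. (Y i n x - Z i x)\<^sup>2 \<partial>?M) \<longlonglongrightarrow> 0" for i unfolding YZ by (rule glim)
  have EXY: "integrable ?M (\<lambda>x. E n x * (X i x * Y i n x))" for i n
    by (rule tendsto_integral_bounded_L2(1)[OF Xm X2 Zm Z2 Ym YI Ylim Em EL Elim em])
  have limXY: "(\<lambda>n. \<integral>x. E n x * (X i x * Y i n x) \<partial>?M) \<longlonglongrightarrow> (\<integral>x. e x * (X i x * Z i x) \<partial>?M)" for i
    by (rule tendsto_integral_bounded_L2(2)[OF Xm X2 Zm Z2 Ym YI Ylim Em EL Elim em])
  have eXZ: "integrable ?M (\<lambda>x. e x * (X i x * Z i x))" for i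
  proof (rule integrable_bounded_mult[OF integrable_mult_L2[OF Xm Zm X2 Z2] em])
    show "AE x in ?M. \<bar>e x\<bar> \<le> L"
      using Elim
    proof eventually_elim
      case (elim x)
      show ?case by (rule LIMSEQ_le_const2[OF tendsto_rabs[OF elim]]) (use EL in blast)
    qed
  qed
  have XK: "X i x * (indicator K x * t) = X i x * t" for i x t
    using test_functions_vanishing(1)[OF \<psi>, of x, folded K_def]
    by (cases "x \<in> K") (auto simp: X_def)

  \<comment> \<open>The equation tested with \<open>exp (a p n) \<psi>\<close>.\<close>
  have zero: "(\<integral>x. E n x * F x \<partial>?M) + a * (\<Sum>i\<in>UNIV. \<integral>x. E n x * (X i x * Y i n x) \<partial>?M) = 0" for n
  proof -
    have "A x \<bullet> grad (\<lambda>x. E n x * \<psi> x) x + B x * (E n x * \<psi> x)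
        = E n x * F x + a * (\<Sum>i\<in>UNIV. E n x * (X i x * Y i n x))" for x
    proof -
      have "(\<Sum>i\<in>UNIV. E n x * (X i x * Y i n x)) = E n x * \<psi> x * (A x \<bullet> grad (p n) x)"
        unfolding Y_def XK
        by (simp add: X_def inner_vec_def grad_def sum_distrib_left mult.assoc)
      then show ?thesis
        unfolding E_def grad_exp_mult[OF p sm] F_def
        by (simp add: inner_add_right algebra_simps)
    qed
    then have "0 = (\<integral>x. E n x * F x + a * (\<Sum>i\<in>UNIV. E n x * (X i x * Y i n x)) \<partial>?M)"
      using eq[OF test_functions_mult[OF \<psi> smE[of n]]] by simp
    also have "\<dots> = (\<integral>x. E n x * F x \<partial>?M) + a * (\<Sum>i\<in>UNIV. \<integral>x. E n x * (X i x * Y i n x) \<partial>?M)"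
      using EF EXY by simp
    finally show ?thesis by simp
  qed
  have "(\<lambda>n. (\<integral>x. E n x * F x \<partial>?M) + a * (\<Sum>i\<in>UNIV. \<integral>x. E n x * (X i x * Y i n x) \<partial>?M))
      \<longlonglongrightarrow> (\<integral>x. e x * F x \<partial>?M) + a * (\<Sum>i\<in>UNIV. \<integral>x. e x * (X i x * Z i x) \<partial>?M)"
    by (intro tendsto_intros limF limXY)
  then have "0 = (\<integral>x. e x * F x \<partial>?M) + a * (\<Sum>i\<in>UNIV. \<integral>x. e x * (X i x * Z i x) \<partial>?M)"
    unfolding zero by (simp add: LIMSEQ_const_iff)
  also have "\<dots> = (\<integral>x. e x * F x + a * (\<Sum>i\<in>UNIV. e x * (X i x * Z i x)) \<partial>?M)"
    using eF eXZ by simp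
  also have "\<dots> = (\<integral>x. e x * (A x \<bullet> grad \<psi> x + a * (A x \<bullet> \<Phi> x) * \<psi> x + B x * \<psi> x) \<partial>?M)"
  proof (rule Bochner_Integration.integral_cong)
    fix x
    have "(\<Sum>i\<in>UNIV. e x * (X i x * Z i x)) = e x * \<psi> x * (A x \<bullet> \<Phi> x)"
      unfolding Z_def XK by (simp add: X_def inner_vec_def sum_distrib_left mult.assoc)
    then show "e x * F x + a * (\<Sum>i\<in>UNIV. e x * (X i x * Z i x))
        = e x * (A x \<bullet> grad \<psi> x + a * (A x \<bullet> \<Phi> x) * \<psi> x + B x * \<psi> x)"
      by (simp add: F_def algebra_simps)
  qed simp
  finally show ?thesis by (simp add: e_def \<Phi>_def)
qed

theorem theorem2p1:
  fixes U :: "(real^'d) set"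
    and \<gamma> k :: real
    and u \<phi> c f \<eta> :: "real^'d \<Rightarrow> real"
    and H :: "real^'d \<Rightarrow> real^'d"
  assumes "CARD('d) \<ge> 2"
    and "open U" and "bounded U"
    and "\<gamma> \<ge> 1"
    and "u \<in> H12 U"
    and "\<phi> \<in> H12 U \<inter> Linfty U"
    and "H \<in> L2 U"
    and "integrable (lebesgue_on U) c"
    and "integrable (lebesgue_on U) (\<lambda>x. c x * u x)"
    and "integrable (lebesgue_on U) f"
    and "k > 0"
    and "\<And>x. x \<in> U \<Longrightarrow> \<eta> x = k * exp (- \<phi> x / \<gamma>)"
  shows
    "(\<forall>\<psi>\<in>test_functions U.
        (\<integral>x. (\<gamma> *\<^sub>R weak_grad U u x) \<bullet> grad \<psi> x
              + ((weak_grad U \<phi> x + H x) \<bullet> weak_grad U u x) * \<psi> x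
              + c x * u x * \<psi> x \<partial>lebesgue_on U)
        = (\<integral>x. f x * \<psi> x \<partial>lebesgue_on U))
     \<longleftrightarrow>
     (\<forall>\<psi>\<in>test_functions U.
        (\<integral>x. ((\<gamma> * \<eta> x) *\<^sub>R weak_grad U u x) \<bullet> grad \<psi> x
              + ((\<eta> x *\<^sub>R H x) \<bullet> weak_grad U u x) * \<psi> x
              + \<eta> x * c x * u x * \<psi> x \<partial>lebesgue_on U)
        = (\<integral>x. \<eta> x * f x * \<psi> x \<partial>lebesgue_on U))"
proof -
  let ?M = "lebesgue_on U"
  have U: "open U" "bounded U" by fact+
  have \<phi>: "\<phi> \<in> H12 U" "\<phi> \<in> Linfty U" using assms by auto
  have pos: "k > 0" "\<gamma> > 0" using assms by auto
  have \<eta>: "\<eta> x = k * exp (- \<phi> x / \<gamma>)" if "x \<in> U" for x using assms that by blast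
  define G \<Phi> where "G = weak_grad U u" and "\<Phi> = weak_grad U \<phi>"
  have G: "G \<in> L2 U" and \<Phi>: "\<Phi> \<in> L2 U" and H: "H \<in> L2 U"
    using weak_grad_L2(1)[OF \<open>u \<in> H12 U\<close>] weak_grad_L2(1)[OF \<phi>(1)] assms
    by (auto simp: G_def \<Phi>_def)
  have \<phi>m: "\<phi> \<in> borel_measurable ?M" using \<phi> by (simp add: Linfty_def)
  have \<eta>m: "\<eta> \<in> borel_measurable ?M"
    using \<phi>m by (subst measurable_cong[where g="\<lambda>x. k * exp (- \<phi> x / \<gamma>)"])
      (auto simp: \<eta> intro!: borel_measurable_times borel_measurable_divide borel_measurable_uminus)
  obtain C where C: "AE x in ?M. \<bar>\<phi> x\<bar> \<le> C" using \<phi>(2) by (auto simp: Linfty_def)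
  have "AE x in ?M. x \<in> U" by (intro AE_I2) simp
  with C have \<eta>B: "AE x in ?M. \<bar>\<eta> x\<bar> \<le> k * exp (C / \<gamma>)"
  proof eventually_elim
    case (elim x)
    then have "- \<phi> x / \<gamma> \<le> C / \<gamma>" using pos by (intro divide_right_mono) auto
    then show ?case using pos elim by (simp add: \<eta> abs_mult)
  qed
  \<comment> \<open>The coefficients of the test function in the two equations, right-hand sides included;
    \<open>B' = \<eta> (B - \<Phi> \<bullet> G)\<close>.\<close>
  define B where "B x = (\<Phi> x + H x) \<bullet> G x + c x * u x - f x" for x
  define B' where "B' x = \<eta> x * (H x \<bullet> G x + c x * u x - f x)" for x
  have B: "integrable ?M B"
    unfolding B_def using L2_integrable_inner[OF L2_add[OF \<Phi> H] G] assms by simp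
  have B': "integrable ?M B'"
    unfolding B'_def using L2_integrable_inner[OF H G] assms
    by (intro integrable_bounded_mult[OF _ \<eta>m \<eta>B]) simp
  have A: "(\<lambda>x. \<gamma> *\<^sub>R G x) \<in> L2 U"
    by (rule L2_scaleR[OF G, where B="\<bar>\<gamma>\<bar>"]) auto
  have A': "(\<lambda>x. (\<gamma> * \<eta> x) *\<^sub>R G x) \<in> L2 U"
    using L2_scaleR[OF A \<eta>m \<eta>B] by (simp add: mult.commute)
  have fI: "integrable ?M (\<lambda>x. f x * \<psi> x)" and f'I: "integrable ?M (\<lambda>x. \<eta> x * f x * \<psi> x)"
    if "\<psi> \<in> test_functions U" for \<psi>
  proof -
    have zero: "(\<lambda>x. 0) \<in> L2 U" by (simp add: L2_def)
    have f: "integrable ?M f" "integrable ?M (\<lambda>x. \<eta> x * f x)"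
      using assms integrable_bounded_mult[OF _ \<eta>m \<eta>B] by auto
    show "integrable ?M (\<lambda>x. f x * \<psi> x)" "integrable ?M (\<lambda>x. \<eta> x * f x * \<psi> x)"
      using integrable_test_functional[OF zero f(1) that U]
        integrable_test_functional[OF zero f(2) that U] by simp_all
  qed
  have shift: "(\<integral>x. g x \<partial>?M) = (\<integral>x. h x \<partial>?M) \<longleftrightarrow> (\<integral>x. q x \<partial>?M) = 0"
    if "integrable ?M q" "integrable ?M h" "\<And>x. g x = q x + h x" for g h q :: "real^'d \<Rightarrow> real"
    using that by simp
  have i_iff: "(\<integral>x. (\<gamma> *\<^sub>R G x) \<bullet> grad \<psi> x + ((\<Phi> x + H x) \<bullet> G x) * \<psi> x + c x * u x * \<psi> x \<partial>?M)
        = (\<integral>x. f x * \<psi> x \<partial>?M) \<longleftrightarrow>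
      (\<integral>x. (\<gamma> *\<^sub>R G x) \<bullet> grad \<psi> x + B x * \<psi> x \<partial>?M) = 0"
    if \<psi>: "\<psi> \<in> test_functions U" for \<psi>
    by (rule shift[OF integrable_test_functional[OF A B \<psi> U] fI[OF \<psi>]])
      (simp add: B_def algebra_simps)
  have ii_iff: "(\<integral>x. ((\<gamma> * \<eta> x) *\<^sub>R G x) \<bullet> grad \<psi> x + ((\<eta> x *\<^sub>R H x) \<bullet> G x) * \<psi> x
          + \<eta> x * c x * u x * \<psi> x \<partial>?M)
        = (\<integral>x. \<eta> x * f x * \<psi> x \<partial>?M) \<longleftrightarrow>
      (\<integral>x. ((\<gamma> * \<eta> x) *\<^sub>R G x) \<bullet> grad \<psi> x + B' x * \<psi> x \<partial>?M) = 0"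
    if \<psi>: "\<psi> \<in> test_functions U" for \<psi>
    by (rule shift[OF integrable_test_functional[OF A' B' \<psi> U] f'I[OF \<psi>]])
      (simp add: B'_def algebra_simps)
  have "(\<forall>\<psi>\<in>test_functions U. (\<integral>x. (\<gamma> *\<^sub>R G x) \<bullet> grad \<psi> x + B x * \<psi> x \<partial>?M) = 0) \<longleftrightarrow>
    (\<forall>\<psi>\<in>test_functions U. (\<integral>x. ((\<gamma> * \<eta> x) *\<^sub>R G x) \<bullet> grad \<psi> x + B' x * \<psi> x \<partial>?M) = 0)"
    (is "?P \<longleftrightarrow> ?Q")
  proof
    assume P: ?P
    show ?Q
    proof
      fix \<psi> assume \<psi>: "\<psi> \<in> test_functions U"
      \<comment> \<open>The derivative of the weight contributes \<open>- \<Phi> \<bullet> G\<close>, which removes the drift from \<open>B\<close>.\<close>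
      have "(\<integral>x. ((\<gamma> * \<eta> x) *\<^sub>R G x) \<bullet> grad \<psi> x + B' x * \<psi> x \<partial>?M)
          = (\<integral>x. k * (exp ((- 1 / \<gamma>) * \<phi> x) * ((\<gamma> *\<^sub>R G x) \<bullet> grad \<psi> x
              + (- 1 / \<gamma>) * ((\<gamma> *\<^sub>R G x) \<bullet> weak_grad U \<phi> x) * \<psi> x + B x * \<psi> x)) \<partial>?M)"
        using pos by (intro Bochner_Integration.integral_cong refl)
          (simp add: \<eta> B_def B'_def \<Phi>_def inner_commute algebra_simps)
      also have "\<dots> = 0"
        using weak_equation_exp_weight[OF U \<phi> A B _ \<psi>, of "- 1 / \<gamma>"] P by simp
      finally show "(\<integral>x. ((\<gamma> * \<eta> x) *\<^sub>R G x) \<bullet> grad \<psi> x + B' x * \<psi> x \<partial>?M) = 0" .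
    qed
  next
    assume Q: ?Q
    show ?P
    proof
      fix \<psi> assume \<psi>: "\<psi> \<in> test_functions U"
      have cancel: "exp ((1 / \<gamma>) * \<phi> x) * \<eta> x = k" if "x \<in> U" for x
        using \<eta>[OF that] by (simp add: exp_minus field_simps)
      have "exp ((1 / \<gamma>) * \<phi> x) * (((\<gamma> * \<eta> x) *\<^sub>R G x) \<bullet> grad \<psi> x
            + (1 / \<gamma>) * (((\<gamma> * \<eta> x) *\<^sub>R G x) \<bullet> weak_grad U \<phi> x) * \<psi> x + B' x * \<psi> x)
          = k * ((\<gamma> *\<^sub>R G x) \<bullet> grad \<psi> x + B x * \<psi> x)" if "x \<in> U" for x
      proof -
        have "exp ((1 / \<gamma>) * \<phi> x) * (((\<gamma> * \<eta> x) *\<^sub>R G x) \<bullet> grad \<psi> x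
            + (1 / \<gamma>) * (((\<gamma> * \<eta> x) *\<^sub>R G x) \<bullet> weak_grad U \<phi> x) * \<psi> x + B' x * \<psi> x)
          = (exp ((1 / \<gamma>) * \<phi> x) * \<eta> x) * ((\<gamma> *\<^sub>R G x) \<bullet> grad \<psi> x + B x * \<psi> x)"
          using pos by (simp add: B_def B'_def \<Phi>_def inner_commute algebra_simps)
        then show ?thesis using cancel[OF that] by simp
      qed
      then have "(\<integral>x. k * ((\<gamma> *\<^sub>R G x) \<bullet> grad \<psi> x + B x * \<psi> x) \<partial>?M)
          = (\<integral>x. exp ((1 / \<gamma>) * \<phi> x) * (((\<gamma> * \<eta> x) *\<^sub>R G x) \<bullet> grad \<psi> x
            + (1 / \<gamma>) * (((\<gamma> * \<eta> x) *\<^sub>R G x) \<bullet> weak_grad U \<phi> x) * \<psi> x + B' x * \<psi> x) \<partial>?M)"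
        by (intro Bochner_Integration.integral_cong refl) simp
      also have "\<dots> = 0"
        using Q by (intro weak_equation_exp_weight[OF U \<phi> A' B' _ \<psi>]) blast
      finally show "(\<integral>x. (\<gamma> *\<^sub>R G x) \<bullet> grad \<psi> x + B x * \<psi> x \<partial>?M) = 0"
        using pos by simp
    qed
  qed
  then show ?thesis
    using i_iff ii_iff unfolding G_def \<Phi>_def by simp
qed

end
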